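(* Let $p$ be an odd prime. Then $$\sum_{k=0}^{p-1}(4k+1)\frac{\binom{2k}{k}^3}{(-64)^k}\equiv\sum_{k=0}^{(p-1)/2}(4k+1)\frac{\binom{2k}{k}^3}{(-64)^k}\equiv p\left(\frac{-1}{p}\right)+p^3E_{p-3}\pmod{p^4},$$ where $\left(\frac{\cdot}{p}\right)$ is the Legendre symbol and $E_n$ denotes the $n$-th Euler number.
   Context: The Euler numbers $E_0,E_1,E_2,\ldots$ are the integers defined by $E_0=1$ and $\sum_{0\le k\le n,\ 2\mid k}\binom{n}{k}E_{n-k}=0$ for $n=1,2,3,\ldots$ (equivalently, $\frac{2e^x}{e^{2x}+1}=\sum_{n\ge 0}E_n\frac{x^n}{n!}$ for $|x|<\pi/2$). For rational numbers $a,b$ whose denominators are prime to $p$, $a\equiv b\pmod{p^r}$ means that $a-b$ is $p^r$ times a rational number with denominator prime to $p$. One has $\left(\frac{-1}{p}\right)=(-1)^{(p-1)/2}$.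
   Formalization: The second congruence is stated only for p ≠ 3, since at p = 3 it fails: the truncated sum is 3/8, the right-hand side is 24, and their difference −189/8 is divisible by 3^3 but not 3^4; the first congruence is kept for every odd prime. *)

theory Defs
  imports "HOL-Number_Theory.Number_Theory"
begin

fun euler_number :: "nat \<Rightarrow> int" where
  "euler_number n = (if n = 0 then 1
     else - (\<Sum>k \<in> {k \<in> {1..n}. even k}. int (n choose k) * euler_number (n - k)))"

declare euler_number.simps [simp del]

lemma euler_number_0: "euler_number 0 = 1"
  by (simp add: euler_number.simps)

lemma euler_number_recurrence:
  assumes "n \<ge> 1"
  shows "(\<Sum>k \<in> {k \<in> {0..n}. even k}. int (n choose k) * euler_number (n - k)) = 0"
proof -
  have "{k \<in> {0..n}. even k} = insert 0 {k \<in> {1..n}. even k}"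
    by (auto simp: Suc_le_eq)
  then have "(\<Sum>k \<in> {k \<in> {0..n}. even k}. int (n choose k) * euler_number (n - k))
      = euler_number n + (\<Sum>k \<in> {k \<in> {1..n}. even k}. int (n choose k) * euler_number (n - k))"
    by (subst \<open>_ = insert 0 _\<close>, subst sum.insert) auto
  then show ?thesis
    using assms by (simp add: euler_number.simps [of n])
qed

definition p_integral :: "nat \<Rightarrow> rat \<Rightarrow> bool" where
  "p_integral p x \<longleftrightarrow> coprime (snd (quotient_of x)) (int p)"

definition rat_cong :: "nat \<Rightarrow> nat \<Rightarrow> rat \<Rightarrow> rat \<Rightarrow> bool" where
  "rat_cong p r a b \<longleftrightarrow> p_integral p a \<and> p_integral p b \<and>
     (\<exists>c. p_integral p c \<and> a - b = of_nat p ^ r * c)"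

text \<open>
  The congruence of the truncated sum to the closed form fails at \<open>p = 3\<close>: the truncated sum is \<open>3/8\<close>, the
  closed form is \<open>- 3 + 27 = 24\<close>, and \<open>3/8 - 24 = - 189/8 = 3^3 * (- 7/8)\<close>.
\<close>

lemma closed_form_fails_at_3:
  "\<not> rat_cong 3 4
      (\<Sum>k = 0..(3 - 1) div 2. of_nat (4 * k + 1) * of_nat ((2 * k) choose k) ^ 3 / (- 64) ^ k)
      (of_nat 3 * of_int (Legendre (- 1) (int 3)) + of_nat 3 ^ 3 * of_int (euler_number (3 - 3)))"
proof
  let ?a = "\<Sum>k = 0..(3 - 1) div 2. of_nat (4 * k + 1) * of_nat ((2 * k) choose k) ^ 3 / (- 64) ^ k :: rat"
  let ?b = "of_nat 3 * of_int (Legendre (- 1) (int 3)) + of_nat 3 ^ 3 * of_int (euler_number (3 - 3)) :: rat"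
  assume "rat_cong 3 4 ?a ?b"
  then obtain c where c: "p_integral 3 c" "?a - ?b = of_nat 3 ^ 4 * c"
    by (auto simp: rat_cong_def)
  have "(y::int)\<^sup>2 mod 3 \<noteq> 2" for y
  proof -
    have "y mod 3 = 0 \<or> y mod 3 = 1 \<or> y mod 3 = 2" by presburger
    then have "(y mod 3)\<^sup>2 mod 3 \<noteq> 2" by auto
    then show ?thesis by (simp add: power_mod)
  qed
  then have L: "Legendre (- 1) (int 3) = - 1"
    by (auto simp: Legendre_def QuadRes_def cong_def)
  have "?a = 3 / 8"
    by (simp add: numeral_eq_Suc)
  moreover have "?b = 24"
    unfolding L by (simp add: euler_number_0)
  ultimately have "c = Fract (- 7) 24"
    using c(2) by (simp add: Fract_of_int_quotient)
  then have "quotient_of c = (- 7, 24)"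
    by (simp add: quotient_of_Fract normalize_def gcd_non_0_int Let_def)
  then show False
    using c(1) by (auto simp: p_integral_def coprime_iff_gcd_eq_1 gcd_non_0_int)
qed

end

theory Submission
  imports Defs "HOL-Computational_Algebra.Formal_Power_Series"
begin

text \<open>
  Write \<open>p = 2n + 1\<close> and \<open>b k = (2k choose k)\<close>. For odd \<open>q = 2m + 1\<close> the terminating well-poised series
  \<open>\<Sum>k (4k + 1) (-1)^k b k / 4^k * (\<Prod>j=1..k. ((2j - 1)^2 - q^2) / ((2j)^2 - q^2))\<close> has the value
  \<open>(-1)^m q\<close>. Lagrange interpolation in \<open>q^2\<close> at \<open>q = 1, 3, ..., 2n + 1\<close>, evaluated at \<open>q = 0\<close>, suggests
  the identity
  \<open>(\<Sum>k\<le>n. (4k + 1) b k ^ 3 / (-64)^k) = (2n + 1)^2 b n ^ 2 / 2^(8n + 1) * (\<Sum>m\<le>n. (-1)^m b (n - m) b (n + m + 1) / (2m + 1))\<close>,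
  which is proved by induction on \<open>n\<close>; the induction step is a coefficient comparison in a product of the
  power series of \<open>sqrt (1 - 4x)\<close> and \<open>sqrt (1 + 4x)\<close>.

  Modulo \<open>p^4\<close> the term \<open>m = n\<close> is \<open>(-1)^n p\<close> by the congruences of Morley and Wolstenholme, here in product form.
  The term \<open>m < n\<close> is \<open>2 p^3 (-1)^m / (2m + 1)^2\<close>, because \<open>(2m + 1) b (n - m) b (n + m + 1)\<close> is \<open>4p\<close> modulo
  \<open>p^2\<close>. As \<open>1 / (2m + 1)^2\<close> is \<open>(2m + 1)^(p - 3)\<close> modulo \<open>p\<close>, the alternating sum over \<open>m\<close> is an Euler number.
  Finally, the terms with \<open>n < k < p\<close> cancel in pairs \<open>k, 3n + 1 - k\<close> modulo \<open>p^4\<close>.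
\<close>

section \<open>Congruences between rational numbers\<close>

text \<open>Any denominator prime to \<open>p\<close> will do, not only the reduced one; the closure
  rules below then just multiply denominators.\<close>

lemma p_integral_iff:
  "p_integral p x \<longleftrightarrow> (\<exists>d. coprime d (int p) \<and> of_int d * x \<in> \<int>)"
proof
  assume "p_integral p x"
  moreover obtain a b where ab: "quotient_of x = (a, b)" by force
  moreover have "x = of_int a / of_int b" "b > 0"
    using quotient_of_div[OF ab] quotient_of_denom_pos[OF ab] by auto
  ultimately have "coprime b (int p)" "of_int b * x = of_int a"
    by (auto simp: p_integral_def)
  then show "\<exists>d. coprime d (int p) \<and> of_int d * x \<in> \<int>" by (metis Ints_of_int)
next
  assume "\<exists>d. coprime d (int p) \<and> of_int d * x \<in> \<int>"
  then obtain d e where d: "coprime d (int p)" "of_int d * x = of_int e"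
    by (auto elim!: Ints_cases)
  obtain a b where ab: "quotient_of x = (a, b)" by force
  have x: "x = of_int a / of_int b" "b > 0" and cop: "coprime a b"
    using quotient_of_div[OF ab] quotient_of_denom_pos[OF ab] quotient_of_coprime[OF ab] by auto
  have "(of_int (d * a) :: rat) = of_int (e * b)"
    using d x by (simp add: field_simps)
  then have "d * a = e * b" by (simp only: of_int_eq_iff)
  then have "b dvd d" using cop by (metis coprime_commute coprime_dvd_mult_left_iff dvd_triv_right)
  then have "coprime b (int p)" using d(1) by (meson coprime_divisors dvd_refl)
  then show "p_integral p x" by (simp add: p_integral_def ab)
qed

lemma p_integral_of_int [simp, intro]: "p_integral p (of_int z)"
  unfolding p_integral_iff by (rule exI[of _ 1]) auto

lemma p_integral_of_nat [simp, intro]: "p_integral p (of_nat z)"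
  using p_integral_of_int[of p "int z"] by simp

lemma p_integral_numeral [simp, intro]: "p_integral p (numeral k)"
  using p_integral_of_int[of p "numeral k"] by simp

lemma p_integral_0 [simp, intro]: "p_integral p 0"
  and p_integral_1 [simp, intro]: "p_integral p 1"
  using p_integral_of_int[of p 0] p_integral_of_int[of p 1] by auto

lemma p_integral_mult [intro]:
  assumes "p_integral p x" "p_integral p y"
  shows "p_integral p (x * y)"
proof -
  obtain d e where d: "coprime d (int p)" "of_int d * x \<in> \<int>" and e: "coprime e (int p)" "of_int e * y \<in> \<int>"
    using assms by (auto simp: p_integral_iff)
  have "of_int (d * e) * (x * y) = (of_int d * x) * (of_int e * y)" by simp
  then show ?thesis
    unfolding p_integral_iff using d e by (intro exI[of _ "d * e"]) (metis Ints_mult coprime_mult_left_iff)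
qed

lemma p_integral_add [intro]:
  assumes "p_integral p x" "p_integral p y"
  shows "p_integral p (x + y)"
proof -
  obtain d e where d: "coprime d (int p)" "of_int d * x \<in> \<int>" and e: "coprime e (int p)" "of_int e * y \<in> \<int>"
    using assms by (auto simp: p_integral_iff)
  have "of_int (d * e) * (x + y) = of_int e * (of_int d * x) + of_int d * (of_int e * y)"
    by (simp add: algebra_simps)
  then show ?thesis
    unfolding p_integral_iff using d e
    by (intro exI[of _ "d * e"]) (metis Ints_mult Ints_add Ints_of_int coprime_mult_left_iff)
qed

lemma p_integral_minus [intro]: "p_integral p x \<Longrightarrow> p_integral p (- x)"
  using p_integral_mult[OF p_integral_of_int[of p "- 1"]] by fastforce

lemma p_integral_diff [intro]: "p_integral p x \<Longrightarrow> p_integral p y \<Longrightarrow> p_integral p (x - y)"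
  using p_integral_add[OF _ p_integral_minus, of p x y] by simp

lemma p_integral_power [intro]: "p_integral p x \<Longrightarrow> p_integral p (x ^ k)"
  by (induction k) auto

lemma p_integral_sum [intro]: "(\<And>i. i \<in> A \<Longrightarrow> p_integral p (f i)) \<Longrightarrow> p_integral p (sum f A)"
  by (induction A rule: infinite_finite_induct) auto

lemma p_integral_inverse_of_int:
  assumes "coprime z (int p)"
  shows "p_integral p (inverse (of_int z))"
  unfolding p_integral_iff by (cases "z = 0"; rule exI[of _ z]) (use assms in auto)

lemma p_integral_inverse_of_nat:
  "coprime k p \<Longrightarrow> p_integral p (inverse (of_nat k))"
  using p_integral_inverse_of_int[of "int k" p] by simp

lemma p_integral_divide [intro]: "p_integral p x \<Longrightarrow> p_integral p (inverse y) \<Longrightarrow> p_integral p (x / y)"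
  by (auto simp: divide_inverse)

text \<open>Integrality of \<open>a\<close> comes for free, since \<open>a\<close> is
  \<open>b\<close> plus an integral number.\<close>

lemma rat_congI:
  "p_integral p b \<Longrightarrow> p_integral p c \<Longrightarrow> a - b = of_nat p ^ r * c \<Longrightarrow> rat_cong p r a b"
  unfolding rat_cong_def
  by (metis add_diff_cancel_left' diff_add_cancel p_integral_add p_integral_mult p_integral_of_nat p_integral_power)

lemma rat_congE:
  assumes "rat_cong p r a b"
  obtains c where "p_integral p c" "a = b + of_nat p ^ r * c"
  using assms by (force simp: rat_cong_def algebra_simps)

lemma rat_cong_imp_integral:
  "rat_cong p r a b \<Longrightarrow> p_integral p a" "rat_cong p r a b \<Longrightarrow> p_integral p b"
  by (auto simp: rat_cong_def)

lemma rat_cong_refl [simp, intro]: "p_integral p a \<Longrightarrow> rat_cong p r a a"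
  by (rule rat_congI[where c = 0]) auto

lemma rat_cong_sym:
  assumes "rat_cong p r a b"
  shows "rat_cong p r b a"
proof -
  obtain c where "p_integral p c" "a = b + of_nat p ^ r * c" using assms by (rule rat_congE)
  then show ?thesis
    using rat_cong_imp_integral[OF assms] by (intro rat_congI[where c = "- c"]) auto
qed

lemma rat_cong_add:
  assumes "rat_cong p r a b" "rat_cong p r c d"
  shows "rat_cong p r (a + c) (b + d)"
proof -
  obtain u v where "p_integral p u" "a = b + of_nat p ^ r * u" "p_integral p v" "c = d + of_nat p ^ r * v"
    using assms by (metis rat_congE)
  then show ?thesis
    using assms[THEN rat_cong_imp_integral(2)]
    by (intro rat_congI[where c = "u + v"]) (auto simp: algebra_simps)
qed

lemma rat_cong_mult:
  assumes "rat_cong p r a b" "rat_cong p r c d"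
  shows "rat_cong p r (a * c) (b * d)"
proof -
  obtain u v where uv: "p_integral p u" "a = b + of_nat p ^ r * u" "p_integral p v" "c = d + of_nat p ^ r * v"
    using assms by (metis rat_congE)
  then show ?thesis
    using assms[THEN rat_cong_imp_integral(1)] assms[THEN rat_cong_imp_integral(2)]
    by (intro rat_congI[where c = "u * c + b * v"] p_integral_add p_integral_mult) (auto simp: algebra_simps)
qed

lemma rat_cong_minus: "rat_cong p r a b \<Longrightarrow> rat_cong p r (- a) (- b)"
  using rat_cong_mult[OF rat_cong_refl[OF p_integral_of_int[of p "- 1"]]] by fastforce

lemma rat_cong_diff: "rat_cong p r a b \<Longrightarrow> rat_cong p r c d \<Longrightarrow> rat_cong p r (a - c) (b - d)"
  using rat_cong_add[OF _ rat_cong_minus, of p r a b c d] by simp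

lemma rat_cong_power: "rat_cong p r a b \<Longrightarrow> rat_cong p r (a ^ k) (b ^ k)"
  by (induction k) (auto intro: rat_cong_mult)

lemma rat_cong_sum:
  "(\<And>i. i \<in> A \<Longrightarrow> rat_cong p r (f i) (g i)) \<Longrightarrow> rat_cong p r (sum f A) (sum g A)"
  by (induction A rule: infinite_finite_induct) (auto intro: rat_cong_add)

lemma rat_cong_trans [trans]:
  assumes "rat_cong p r a b" "rat_cong p r b c"
  shows "rat_cong p r a c"
  using rat_cong_diff[OF rat_cong_add[OF assms], of b b] rat_cong_imp_integral(2)[OF assms(1)] by simp

lemma rat_cong_mono:
  assumes "rat_cong p r a b" "s \<le> r"
  shows "rat_cong p s a b"
proof -
  obtain u where u: "p_integral p u" "a = b + of_nat p ^ r * u" using assms by (metis rat_congE)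
  then have "a - b = of_nat p ^ s * (of_nat p ^ (r - s) * u)"
    using assms(2) by (simp flip: mult.assoc power_add)
  then show ?thesis
    using assms(1) u
    by (intro rat_congI[where c = "of_nat p ^ (r - s) * u"] p_integral_mult p_integral_power)
      (auto simp: rat_cong_def)
qed

text \<open>A factor \<open>p ^ s\<close> raises the modulus: this is how congruences modulo
  \<open>p\<close> and \<open>p ^ 3\<close> below become congruences modulo
  \<open>p ^ 4\<close>.\<close>

lemma rat_cong_scale:
  assumes "rat_cong p r a b"
  shows "rat_cong p (s + r) (of_nat p ^ s * a) (of_nat p ^ s * b)"
  using assms by (elim rat_congE, intro rat_congI)
    (use assms in \<open>auto simp: rat_cong_def algebra_simps power_add\<close>)

text \<open>As \<open>1 / a = b / (a b)\<close> and \<open>1 / b = a / (a b)\<close>, it suffices to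
  multiply the congruence by the integral number \<open>1 / (a b)\<close>.\<close>

lemma rat_cong_inverse:
  assumes "rat_cong p r a b" "p_integral p (inverse a)" "p_integral p (inverse b)" "a \<noteq> 0" "b \<noteq> 0"
  shows "rat_cong p r (inverse a) (inverse b)"
proof -
  have "rat_cong p r (inverse a * inverse b * b) (inverse a * inverse b * a)"
    using assms by (intro rat_cong_mult rat_cong_refl) (auto intro: rat_cong_sym)
  then show ?thesis using assms by (simp add: field_simps)
qed

lemma rat_cong_mult_cancel:
  assumes "rat_cong p r (u * a) (u * b)" "p_integral p (inverse u)" "u \<noteq> 0"
  shows "rat_cong p r a b"
  using rat_cong_mult[OF assms(1) rat_cong_refl[OF assms(2)]] assms(3) by (simp add: field_simps)

lemma rat_cong_of_int:
  assumes "[a = b] (mod int p ^ r)"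
  shows "rat_cong p r (of_int a) (of_int b)"
proof -
  obtain k where "a - b = int p ^ r * k" using assms by (auto simp: cong_iff_dvd_diff)
  then have "(of_int a - of_int b :: rat) = of_nat p ^ r * of_int k"
    by (metis of_int_diff of_int_mult of_int_of_nat_eq of_int_power)
  then show ?thesis by (intro rat_congI[where c = "of_int k"]) simp_all
qed

section \<open>An identity for sums of cubes of central binomial coefficients\<close>

definition cbin :: "nat \<Rightarrow> rat" where
  "cbin k = of_nat ((2 * k) choose k)"

lemma cbin_0 [simp]: "cbin 0 = 1"
  by (simp add: cbin_def)

lemma cbin_pos: "cbin k > 0"
  by (simp add: cbin_def)

lemma Suc_times_central_binomial:
  "Suc k * ((2 * Suc k) choose Suc k) = 2 * (2 * k + 1) * ((2 * k) choose k)"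
proof -
  have "Suc k * (Suc (2 * k + 1) choose Suc k) = Suc (2 * k + 1) * ((2 * k + 1) choose k)"
    by (rule Suc_times_binomial)
  also have "\<dots> = 2 * (Suc k * ((2 * k + 1) choose Suc k))"
    using binomial_symmetric[of "Suc k" "2 * k + 1"] by simp
  also have "Suc k * ((2 * k + 1) choose Suc k) = (2 * k + 1) * ((2 * k) choose k)"
    using Suc_times_binomial[of k "2 * k"] by simp
  finally show ?thesis by (simp only: mult.assoc mult_Suc_right) simp
qed

lemma cbin_Suc: "of_nat (Suc k) * cbin (Suc k) = 2 * (2 * of_nat k + 1) * cbin k"
proof -
  have "(of_nat (Suc k * ((2 * Suc k) choose Suc k)) :: rat) = of_nat (2 * (2 * k + 1) * ((2 * k) choose k))"
    by (subst Suc_times_central_binomial) (rule refl)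
  then show ?thesis by (simp only: cbin_def of_nat_mult of_nat_add of_nat_numeral of_nat_1)
qed

lemma cbin_alt_Suc:
  "of_nat (Suc k) * ((-1) ^ Suc k * cbin (Suc k)) = - 2 * (2 * of_nat k + 1) * ((-1) ^ k * cbin k)"
proof -
  have "of_nat (Suc k) * ((-1) ^ Suc k * cbin (Suc k)) = (-1) ^ Suc k * (of_nat (Suc k) * cbin (Suc k))"
    by (simp only: mult_ac)
  then show ?thesis unfolding cbin_Suc by (simp only: power_Suc) (simp only: mult_ac mult_minus_left mult_1_left)
qed

text \<open>The recurrence is the differential equation of \<open>(1 - 2ax)^(-1/2)\<close>, read
  coefficientwise.\<close>

lemma fps_deriv_of_recurrence:
  fixes f :: "nat \<Rightarrow> 'a :: comm_ring_1"
  assumes "\<And>k. of_nat (Suc k) * f (Suc k) = a * (2 * of_nat k + 1) * f k"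
  shows "(1 - fps_const (2 * a) * fps_X) * fps_deriv (Abs_fps f) = fps_const a * Abs_fps f"
proof (rule fps_ext)
  fix k
  have "fps_nth (fps_X * fps_deriv (Abs_fps f)) k = of_nat k * f k"
    by (cases k) simp_all
  then show "fps_nth ((1 - fps_const (2 * a) * fps_X) * fps_deriv (Abs_fps f)) k
      = fps_nth (fps_const a * Abs_fps f) k"
    using assms[of k] by (simp add: left_diff_distrib mult.assoc) (simp add: algebra_simps)
qed

text \<open>This is \<open>(1 - 4x)^(-1/2)\<close>.\<close>

definition cbin_fps :: "rat fps" where
  "cbin_fps = Abs_fps cbin"

text \<open>This is \<open>(1 + 4x)^(-1/2)\<close>.\<close>

definition cbin_alt_fps :: "rat fps" where
  "cbin_alt_fps = Abs_fps (\<lambda>i. (-1) ^ i * cbin i)"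

lemma fps_deriv_cbin_fps:
  "(1 - 4 * fps_X) * fps_deriv cbin_fps = 2 * cbin_fps"
  "(1 + 4 * fps_X) * fps_deriv cbin_alt_fps = - 2 * cbin_alt_fps"
  using fps_deriv_of_recurrence[of cbin 2] fps_deriv_of_recurrence[of "\<lambda>i. (-1) ^ i * cbin i" "-2", OF cbin_alt_Suc] cbin_Suc
  by (simp_all add: cbin_fps_def cbin_alt_fps_def numeral_fps_const flip: fps_const_neg)

text \<open>The product of the two series is \<open>(1 - 16 x^2)^(-1/2)\<close>, which is the series
  of \<open>cbin\<close> at \<open>4 x^2\<close>. The proof uses its differential equation
  \<open>(1 - 16 x^2) H' = 16 x H\<close>.\<close>

lemma alternating_central_binomial_convolution:
  "fps_nth (cbin_alt_fps * cbin_fps) (2 * n) = 4 ^ n * cbin n"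
proof -
  define H where "H = cbin_alt_fps * cbin_fps"
  have "(1 - 16 * fps_X\<^sup>2) * fps_deriv H
      = (1 - 4 * fps_X) * cbin_fps * ((1 + 4 * fps_X) * fps_deriv cbin_alt_fps)
        + (1 + 4 * fps_X) * cbin_alt_fps * ((1 - 4 * fps_X) * fps_deriv cbin_fps)"
    by (simp add: H_def algebra_simps power2_eq_square)
  also have "\<dots> = 16 * fps_X * H"
    unfolding fps_deriv_cbin_fps by (simp add: H_def algebra_simps)
  \<comment> \<open>Solved for \<open>H'\<close>, the equation yields a recurrence with index gap 2,
    so the constant coefficient determines all even ones.\<close>
  finally have H': "fps_deriv H = fps_const 16 * (fps_X * (fps_X * fps_deriv H + H))"
    by (simp add: algebra_simps power2_eq_square numeral_fps_const)
  have rec: "of_nat (k + 2) * fps_nth H (k + 2) = 16 * of_nat (k + 1) * fps_nth H k" for k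
    using arg_cong[OF H', of "\<lambda>F. fps_nth F (Suc k)"]
    by (cases k) (simp_all add: algebra_simps)
  show ?thesis unfolding H_def[symmetric]
  proof (induction n)
    case 0
    then show ?case by (simp add: H_def cbin_fps_def cbin_alt_fps_def)
  next
    case (Suc n)
    have "of_nat (2 * n + 2) * fps_nth H (2 * n + 2) = 16 * of_nat (2 * n + 1) * (4 ^ n * cbin n)"
      using rec[of "2 * n"] Suc by simp
    also have "\<dots> = 2 * 4 ^ Suc n * (2 * (2 * of_nat n + 1) * cbin n)" by (simp add: algebra_simps)
    also have "\<dots> = of_nat (2 * n + 2) * (4 ^ Suc n * cbin (Suc n))"
      by (subst cbin_Suc[symmetric]) (simp add: algebra_simps)
    finally have "fps_nth H (2 * n + 2) = 4 ^ Suc n * cbin (Suc n)"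
      by (subst (asm) mult_left_cancel) (auto simp del: of_nat_Suc of_nat_add)
    then show ?case by simp
  qed
qed

section \<open>Convolutions of the coefficients of the square roots\<close>

definition scbin :: "nat \<Rightarrow> rat" where
  "scbin k = cbin k / (2 * of_nat k - 1)"

lemma two_of_nat_neq_1: "2 * (of_nat k :: rat) - 1 \<noteq> 0"
proof
  assume "2 * (of_nat k :: rat) - 1 = 0"
  then have "(of_nat (2 * k) :: rat) = of_nat 1" by simp
  then have "2 * k = 1" by (simp only: of_nat_eq_iff)
  then show False by presburger
qed

text \<open>If \<open>Abs_fps f\<close> is \<open>(1 - 2ax)^(-1/2)\<close>, then
  \<open>Abs_fps s\<close> is \<open>- (1 - 2ax)^(1/2)\<close>. Both claims rest on
  \<open>(k + 1) s (k + 1) = a f k\<close>, the second also on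
  \<open>s k = 2k s k - f k\<close>.\<close>

lemma fps_of_recurrence_div:
  fixes f :: "nat \<Rightarrow> rat"
  assumes "\<And>k. of_nat (Suc k) * f (Suc k) = a * (2 * of_nat k + 1) * f k"
  defines "s \<equiv> \<lambda>k. f k / (2 * of_nat k - 1)"
  shows "fps_deriv (Abs_fps s) = fps_const a * Abs_fps f"
    and "Abs_fps s = (fps_const (2 * a) * fps_X - 1) * Abs_fps f"
proof -
  have s: "of_nat (Suc k) * s (Suc k) = a * f k" for k
    using assms(1)[of k] two_of_nat_neq_1[of "Suc k"] by (simp add: s_def field_simps)
  show "fps_deriv (Abs_fps s) = fps_const a * Abs_fps f"
    using s by (intro fps_ext) (simp add: algebra_simps)
  show "Abs_fps s = (fps_const (2 * a) * fps_X - 1) * Abs_fps f"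
  proof (rule fps_ext)
    fix k
    have "s k = 2 * (of_nat k * s k) - f k"
      using two_of_nat_neq_1[of k] by (simp add: s_def field_simps)
    then show "fps_nth (Abs_fps s) k = fps_nth ((fps_const (2 * a) * fps_X - 1) * Abs_fps f) k"
      using s[of "k - 1"] by (cases k) (simp_all add: left_diff_distrib mult.assoc)
  qed
qed

text \<open>The power series with coefficients \<open>scbin k\<close> is \<open>- sqrt (1 - 4 x)\<close>, and the sum below
  is a coefficient of the Wronskian of \<open>sqrt (1 - 4 x)\<close> and \<open>sqrt (1 + 4 x)\<close>.\<close>

lemma scbin_convolution_full:
  "(\<Sum>i=0..2 * n + 1. (-1) ^ i * (of_nat (2 * n + 1 - i) - of_nat i) * scbin i * scbin (2 * n + 1 - i))
     = - (4 ^ Suc n) * cbin n"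
proof -
  define F G where "F = Abs_fps scbin" and "G = Abs_fps (\<lambda>i. (-1) ^ i * scbin i)"
  have F: "fps_deriv F = 2 * cbin_fps" "F = (4 * fps_X - 1) * cbin_fps"
    using fps_of_recurrence_div[of cbin 2] cbin_Suc
    by (simp_all add: F_def cbin_fps_def scbin_def[abs_def] numeral_fps_const)
  have G: "fps_deriv G = - 2 * cbin_alt_fps" "G = - (4 * fps_X + 1) * cbin_alt_fps"
    using fps_of_recurrence_div[of "\<lambda>i. (-1) ^ i * cbin i" "-2", OF cbin_alt_Suc]
    by (simp_all add: G_def cbin_alt_fps_def scbin_def numeral_fps_const flip: fps_const_neg)
  \<comment> \<open>\<open>fps_XD\<close> multiplies the coefficient of \<open>x^k\<close> by
    \<open>k\<close>, which produces the weight \<open>(2n + 1 - i) - i\<close> of the sum.\<close>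
  have "G * fps_XD F - fps_XD G * F = fps_X * (G * fps_deriv F - fps_deriv G * F)"
    by (simp add: fps_XD_def algebra_simps)
  \<comment> \<open>Once everything is expressed by the two inverse square roots, the Wronskian is
    \<open>-4\<close> times their product: the multiples of \<open>x\<close> cancel.\<close>
  also have "\<dots> = fps_X * (- 4 * (cbin_alt_fps * cbin_fps))"
    unfolding F(1) G(1) unfolding F(2) G(2) by (simp add: algebra_simps)
  also have "\<dots> = fps_X * (fps_const (- 4) * (cbin_alt_fps * cbin_fps))"
    by (simp add: numeral_fps_const flip: fps_const_neg)
  finally have "fps_nth (G * fps_XD F - fps_XD G * F) (2 * n + 1) = - 4 * (4 ^ n * cbin n)"
    using alternating_central_binomial_convolution[of n] by (simp del: fps_mult_nth_0)
  also have "fps_nth (G * fps_XD F - fps_XD G * F) (2 * n + 1) =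
    (\<Sum>i=0..2 * n + 1. (-1) ^ i * (of_nat (2 * n + 1 - i) - of_nat i) * scbin i * scbin (2 * n + 1 - i))"
    by (simp only: fps_sub_nth fps_mult_nth sum_subtractf[symmetric])
      (intro sum.cong refl, simp add: F_def G_def algebra_simps)
  finally show ?thesis by simp
qed

text \<open>Folding of the full convolution: under \<open>i -> 2n + 1 - i\<close> both the sign
  \<open>(-1)^i\<close> and the weight are negated, so each term occurs twice;
  \<open>i = n - m\<close> turns the weight into \<open>2m + 1\<close>.\<close>

lemma scbin_convolution:
  "(\<Sum>m=0..n. (-1) ^ m * of_nat (2 * m + 1) * scbin (n - m) * scbin (n + m + 1))
     = - ((-1) ^ n) * 2 ^ (2 * n + 1) * cbin n"
proof -
  define g where "g i = (-1) ^ i * (of_nat (2 * n + 1 - i) - of_nat i) * scbin i * scbin (2 * n + 1 - i)" for i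
  have neg: "(-1 :: rat) ^ (2 * n + 1 - i) = - ((-1) ^ i)" if "i \<le> 2 * n + 1" for i
  proof -
    have "(-1 :: rat) ^ (2 * n + 1 - i) * (-1) ^ i = (-1) ^ (2 * n + 1)"
      using that by (simp only: le_add_diff_inverse2 flip: power_add)
    then show ?thesis by (cases "even i") auto
  qed
  have sym: "g (2 * n + 1 - i) = g i" if "i \<le> 2 * n + 1" for i
  proof -
    have "- e * (x - y) * a * b = e * (y - x) * b * a" for e x y a b :: rat
      by (simp add: algebra_simps)
    then show ?thesis
      using that unfolding g_def neg[OF that] by (simp only: diff_diff_cancel)
  qed
  have U: "{0..2 * n + 1} = {0..n} \<union> {n + 1..2 * n + 1}" by auto
  have "sum g {0..2 * n + 1} = sum g {0..n} + sum g {n + 1..2 * n + 1}"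
    unfolding U by (rule sum.union_disjoint) auto
  also have "sum g {n + 1..2 * n + 1} = (\<Sum>i=0..n. g (2 * n + 1 - i))"
    by (rule sum.reindex_bij_witness[where i = "\<lambda>i. 2 * n + 1 - i" and j = "\<lambda>i. 2 * n + 1 - i"]) auto
  also have "\<dots> = sum g {0..n}"
    by (rule sum.cong[OF refl], rule sym) simp
  also have "sum g {0..n} = (\<Sum>m=0..n. g (n - m))"
    by (rule sum.reindex_bij_witness[where i = "\<lambda>i. n - i" and j = "\<lambda>i. n - i"]) auto
  also have "\<dots> = (\<Sum>m=0..n. (-1) ^ n * ((-1) ^ m * of_nat (2 * m + 1) * scbin (n - m) * scbin (n + m + 1)))"
  proof (rule sum.cong)
    fix m assume "m \<in> {0..n}"
    then obtain k where n: "n = m + k" by (metis atLeastAtMost_iff le_Suc_ex)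
    have "2 * n + 1 - (n - m) = n + m + 1" "(-1 :: rat) ^ (n - m) = (-1) ^ n * (-1) ^ m"
      by (simp_all add: n power_add)
    then show "g (n - m) = (-1) ^ n * ((-1) ^ m * of_nat (2 * m + 1) * scbin (n - m) * scbin (n + m + 1))"
      by (simp add: g_def)
  qed simp
  finally have "2 * ((-1) ^ n * (\<Sum>m=0..n. (-1) ^ m * of_nat (2 * m + 1) * scbin (n - m) * scbin (n + m + 1)))
      = sum g {0..2 * n + 1}"
    by (simp add: sum_distrib_left)
  also have "\<dots> = - (4 ^ Suc n) * cbin n"
    using scbin_convolution_full[of n] by (simp add: g_def)
  also have "- (4 ^ Suc n) * cbin n = 2 * (- (2 ^ (2 * n + 1)) * cbin n)"
    using power_mult[of "2 :: rat" 2 n] by simp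
  finally have "(-1) ^ n * (\<Sum>m=0..n. (-1) ^ m * of_nat (2 * m + 1) * scbin (n - m) * scbin (n + m + 1))
      = - (2 ^ (2 * n + 1)) * cbin n"
    unfolding mult_left_cancel[OF zero_neq_numeral[symmetric]] .
  moreover have "(-1 :: rat) ^ n * (-1) ^ n = 1" by (simp flip: power_add)
  ultimately show ?thesis
    by (metis (no_types, lifting) mult.assoc mult.left_commute mult_1_left mult_minus_left)
qed

section \<open>The closed form of the cube sum, by induction on \<open>n\<close>\<close>

text \<open>For each \<open>m\<close> the increment in \<open>n\<close> of a summand in
  \<open>binomial_cube_sum\<close> is a summand of \<open>scbin_convolution\<close> times a factor
  free of \<open>m\<close>, so the increments can be summed in closed form.\<close>

lemma binomial_cube_sum_step:
  assumes "m \<le> n"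
  shows "of_nat (2 * n + 3) ^ 2 * cbin (Suc n) ^ 2 / 2 ^ (8 * n + 9)
           * ((-1) ^ m * cbin (Suc n - m) * cbin (Suc n + m + 1) / of_nat (2 * m + 1))
         - of_nat (2 * n + 1) ^ 2 * cbin n ^ 2 / 2 ^ (8 * n + 1)
           * ((-1) ^ m * cbin (n - m) * cbin (n + m + 1) / of_nat (2 * m + 1))
         = - (of_nat (4 * n + 5) * cbin (Suc n) ^ 2 / 2 ^ (8 * n + 9))
             * ((-1) ^ m * of_nat (2 * m + 1) * scbin (Suc n - m) * scbin (Suc n + m + 1))"
proof -
  obtain k where n: "n = m + k" using assms by (metis le_Suc_ex)
  define x y :: rat where "x = of_nat m" and "y = of_nat k"
  have [simp]: "x \<ge> 0" "y \<ge> 0" by (simp_all add: x_def y_def)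
  define u v w where "u = cbin k" and "v = cbin (2 * m + k + 1)" and "w = cbin (m + k)"
  have u: "cbin (Suc k) = 2 * (2 * y + 1) * u / (y + 1)" and
    v: "cbin (2 * m + k + 2) = 2 * (4 * x + 2 * y + 3) * v / (2 * x + y + 2)" and
    w: "cbin (Suc (m + k)) = 2 * (2 * x + 2 * y + 1) * w / (x + y + 1)"
    using cbin_Suc[of k] cbin_Suc[of "2 * m + k + 1"] cbin_Suc[of "m + k"] cbin_pos
    by (simp_all add: x_def y_def u_def v_def w_def field_simps)
  have y: "2 * y + 1 > 0" and xy: "4 * x + 2 * y + 3 > 0" by (simp_all add: add_nonneg_pos)
  have cancel: "2 * b * t / a / b = 2 * t / a" if "b > 0" for a b t :: rat
    using that by simp
  have den: "2 * of_nat (Suc k) - 1 = 2 * y + 1" "2 * of_nat (2 * m + k + 2) - 1 = 4 * x + 2 * y + 3"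
    by (simp_all add: x_def y_def)
  \<comment> \<open>The odd factor in the recurrence of \<open>cbin\<close> is exactly the
    denominator of \<open>scbin\<close> and cancels.\<close>
  have su: "scbin (Suc k) = 2 * u / (y + 1)"
    unfolding scbin_def u den by (rule cancel[OF y])
  have sv: "scbin (2 * m + k + 2) = 2 * v / (2 * x + y + 2)"
    unfolding scbin_def v den by (rule cancel[OF xy])
  define D M z where "D = (y + 1) * (2 * x + y + 2)" and "M = x + y + 1" and "z = 2 * x + 1"
  define E e where "E = (2 :: rat) ^ (8 * n + 1)" and "e = (-1 :: rat) ^ m"
  have pos: "M > 0" "z > 0" "E > 0" "y + 1 > 0" "2 * x + y + 2 > 0"
    by (simp_all add: M_def z_def E_def add_nonneg_pos)
  then have "D > 0" by (simp add: D_def)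
  \<comment> \<open>The three fractions share the factor \<open>N^2 w^2 e u v / E\<close> and the
    denominator \<open>16 M^2 D z\<close>; what remains is this polynomial identity.\<close>
  have core: "(2 * x + 2 * y + 3)\<^sup>2 * (2 * y + 1) * (4 * x + 2 * y + 3) - 16 * M\<^sup>2 * D
      = - (4 * x + 4 * y + 5) * z\<^sup>2"
    unfolding D_def M_def z_def by (simp add: power2_eq_square algebra_simps)
  have idx: "Suc n - m = Suc k" "Suc n + m + 1 = 2 * m + k + 2" "n - m = k" "n + m + 1 = 2 * m + k + 1"
    by (simp_all add: n)
  have val: "of_nat (2 * n + 3) = 2 * x + 2 * y + 3" "of_nat (2 * n + 1) = 2 * x + 2 * y + 1"
    "of_nat (4 * n + 5) = 4 * x + 4 * y + 5" "of_nat (2 * m + 1) = z" "cbin k = u"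
    "cbin (2 * m + k + 1) = v" "cbin n = w" "cbin (Suc n) = 2 * (2 * x + 2 * y + 1) * w / M"
    "(-1) ^ m = e" "2 ^ (8 * n + 1) = E" "2 ^ (8 * n + 9) = 256 * E"
    using w by (simp_all add: n x_def y_def z_def M_def u_def v_def w_def e_def E_def power_add)
  have 1: "P\<^sup>2 * (2 * N * w / M)\<^sup>2 / (256 * E) * (e * (2 * Q * u / a) * (2 * R * v / b) / z)
      = N\<^sup>2 * w\<^sup>2 * e * u * v / E * (P\<^sup>2 * Q * R) / (16 * M\<^sup>2 * (a * b) * z)"
    if "a > 0" "b > 0" for P N Q R a b
    using that pos by (simp add: power_divide power_mult_distrib frac_eq_eq)
  have 2: "N\<^sup>2 * w\<^sup>2 / E * (e * u * v / z) = N\<^sup>2 * w\<^sup>2 * e * u * v / E * (16 * M\<^sup>2 * D) / (16 * M\<^sup>2 * D * z)" for N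
    using \<open>D > 0\<close> pos by simp
  have 3: "- (P * (2 * N * w / M)\<^sup>2 / (256 * E)) * (e * z * (2 * u / a) * (2 * v / b))
      = N\<^sup>2 * w\<^sup>2 * e * u * v / E * (- P * z\<^sup>2) / (16 * M\<^sup>2 * (a * b) * z)"
    if "a > 0" "b > 0" for P N a b
    using that pos by (simp add: power_divide power_mult_distrib frac_eq_eq) (simp add: power2_eq_square)
  show ?thesis
    unfolding idx val u v su sv 1[OF pos(4,5)] 2 3[OF pos(4,5)]
    unfolding D_def[symmetric] core[symmetric] by (simp only: right_diff_distrib diff_divide_distrib)
qed

lemma binomial_cube_sum:
  "(\<Sum>k=0..n. of_nat (4 * k + 1) * cbin k ^ 3 / (-64) ^ k)
    = of_nat (2 * n + 1) ^ 2 * cbin n ^ 2 / 2 ^ (8 * n + 1)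
      * (\<Sum>m=0..n. (-1) ^ m * cbin (n - m) * cbin (n + m + 1) / of_nat (2 * m + 1))"
proof (induction n)
  case 0
  show ?case using cbin_Suc[of 0] by simp
next
  case (Suc n)
  define A where "A n = of_nat (2 * n + 1) ^ 2 * cbin n ^ 2 / 2 ^ (8 * n + 1)" for n
  define Q where "Q n m = (-1) ^ m * cbin (n - m) * cbin (n + m + 1) / of_nat (2 * m + 1)" for n m
  define c where "c = - (of_nat (4 * n + 5) * cbin (Suc n) ^ 2 / 2 ^ (8 * n + 9))"
  define W where "W m = (-1) ^ m * of_nat (2 * m + 1) * scbin (Suc n - m) * scbin (Suc n + m + 1)" for m
  have "A (Suc n) * Q (Suc n) m - A n * Q n m = c * W m" if "m \<in> {0..n}" for m
    using binomial_cube_sum_step[of m n] that by (simp add: A_def Q_def c_def W_def add_ac)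
  then have "(\<Sum>m=0..n. A (Suc n) * Q (Suc n) m) - (\<Sum>m=0..n. A n * Q n m) = (\<Sum>m=0..n. c * W m)"
    by (simp flip: sum_subtractf)
  \<comment> \<open>The index \<open>m = n + 1\<close> is absent from the sum for \<open>n\<close>;
    since \<open>scbin 0 = - 1\<close>, its term still fits the pattern
    \<open>c * W m\<close>.\<close>
  moreover have "A (Suc n) * Q (Suc n) (Suc n) = c * W (Suc n)"
  proof -
    define a b where "a = (of_nat (2 * n + 3) :: rat)" and "b = (of_nat (4 * n + 5) :: rat)"
    have idx: "2 * Suc n + 1 = 2 * n + 3" "8 * Suc n + 1 = 8 * n + 9" by simp_all
    have sc: "scbin 0 = - 1" "scbin (Suc n + Suc n + 1) = cbin (Suc n + Suc n + 1) / b"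
      by (simp_all add: scbin_def b_def)
    have "a \<noteq> 0" "b \<noteq> 0" unfolding a_def b_def by (simp_all only: of_nat_eq_0_iff)
    then have "a\<^sup>2 * C\<^sup>2 / E * (e * 1 * U / a) = - (b * C\<^sup>2 / E) * (e * a * - 1 * (U / b))" for C E e U :: rat
      by (simp add: power2_eq_square)
    then show ?thesis
      unfolding A_def Q_def c_def W_def idx diff_self_eq_0 cbin_0 sc
      unfolding a_def[symmetric] b_def[symmetric] by this
  qed
  ultimately have "(\<Sum>m=0..Suc n. A (Suc n) * Q (Suc n) m) = (\<Sum>m=0..n. A n * Q n m) + c * sum W {0..Suc n}"
    by (simp add: sum_distrib_left algebra_simps)
  \<comment> \<open>\<open>scbin_convolution\<close> at \<open>n + 1\<close> collapses the
    increments into the next summand of the cube sum.\<close>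
  also have "c * sum W {0..Suc n} = of_nat (4 * Suc n + 1) * cbin (Suc n) ^ 3 / (-64) ^ Suc n"
  proof -
    define e where "e = (-1 :: rat) ^ Suc n"
    have e: "e = 1 \<or> e = - 1" by (cases "even n") (auto simp: e_def)
    have "sum W {0..Suc n} = - e * 2 ^ (2 * n + 3) * cbin (Suc n)"
      using scbin_convolution[of "Suc n"] by (simp add: W_def e_def power_add)
    moreover have "(2 :: rat) ^ (8 * n + 9) = 2 ^ (2 * n + 3) * 64 ^ Suc n"
      using power_mult[of "2 :: rat" 6 "Suc n"] power_add[of "2 :: rat" "2 * n + 3" "6 * Suc n"]
      by (simp add: add_ac)
    moreover have "(-64 :: rat) ^ Suc n = e * 64 ^ Suc n"
      using power_mult_distrib[of "-1 :: rat" 64 "Suc n"] by (simp add: e_def)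
    moreover have "of_nat (4 * n + 5) = (of_nat (4 * Suc n + 1) :: rat)" by simp
    moreover have "- (d * C\<^sup>2 / (E * F)) * (- e * E * C) = d * C ^ 3 / (e * F)" if "E \<noteq> 0" for d C E F
      using that e by (elim disjE) (simp_all add: power2_eq_square power3_eq_cube)
    moreover have "(2 :: rat) ^ (2 * n + 3) \<noteq> 0" by simp
    ultimately show ?thesis unfolding c_def by (simp only: not_False_eq_True)
  qed
  also have "(\<Sum>m=0..n. A n * Q n m) = (\<Sum>k=0..n. of_nat (4 * k + 1) * cbin k ^ 3 / (-64) ^ k)"
    unfolding Suc.IH by (simp only: A_def Q_def sum_distrib_left)
  finally show ?case
    unfolding A_def Q_def sum_distrib_left[symmetric] sum.atLeast0_atMost_Suc[of "\<lambda>k. of_nat (4 * k + 1) * cbin k ^ 3 / (-64) ^ k"]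
    by (rule sym)
qed

section \<open>Euler numbers\<close>

text \<open>This is \<open>1 / cosh x\<close>, as \<open>euler_fps_times_cosh\<close>
  confirms.\<close>

definition euler_fps :: "rat fps" where
  "euler_fps = Abs_fps (\<lambda>k. of_int (euler_number k) / fact k)"

text \<open>In terms of Euler polynomials this is \<open>2^r E_r((y + 1) / 2)\<close>; its
  exponential generating function is \<open>e^(yx) / cosh x\<close>.\<close>

definition euler_sum :: "nat \<Rightarrow> int \<Rightarrow> int" where
  "euler_sum r y = (\<Sum>k=0..r. int (r choose k) * y ^ k * euler_number (r - k))"

lemma euler_sum_eq_fps_nth:
  "of_int (euler_sum r y) = fact r * fps_nth (fps_exp (of_int y) * euler_fps) r"
  unfolding euler_sum_def fps_mult_nth of_int_sum sum_distrib_left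
  by (intro sum.cong refl) (simp add: euler_fps_def binomial_fact)

lemma euler_sum_0 [simp]: "euler_sum r 0 = euler_number r"
proof -
  have "euler_sum r 0 = (\<Sum>k=0..r. if k = 0 then euler_number r else 0)"
    unfolding euler_sum_def by (intro sum.cong refl) auto
  then show ?thesis by simp
qed

text \<open>In each coefficient the odd \<open>k\<close> cancel and the even ones are doubled, which
  leaves the defining recurrence.\<close>

lemma euler_fps_times_cosh: "(fps_exp 1 + fps_exp (- 1)) * euler_fps = 2"
proof (rule fps_ext)
  fix n
  have "fact n * fps_nth ((fps_exp 1 + fps_exp (- 1)) * euler_fps) n = of_int (euler_sum n 1 + euler_sum n (- 1))"
    by (simp add: distrib_right distrib_left euler_sum_eq_fps_nth)
  also have "euler_sum n 1 + euler_sum n (- 1)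
      = (\<Sum>k=0..n. if even k then 2 * (int (n choose k) * euler_number (n - k)) else 0)"
    unfolding euler_sum_def sum.distrib[symmetric] by (intro sum.cong refl) auto
  also have "\<dots> = 2 * (\<Sum>k \<in> {k \<in> {0..n}. even k}. int (n choose k) * euler_number (n - k))"
    unfolding sum_distrib_left by (intro sum.mono_neutral_cong_right) auto
  also have "\<dots> = (if n = 0 then 2 else 0)"
  proof (cases "n = 0")
    case True
    then have "{k \<in> {0..n}. even k} = {0}" by auto
    with True show ?thesis by (simp add: euler_number_0)
  qed (use euler_number_recurrence[of n] in simp)
  finally show "fps_nth ((fps_exp 1 + fps_exp (- 1)) * euler_fps) n = fps_nth 2 n"
    by (auto simp: fps_numeral_nth split: if_splits)
qed

text \<open>\<open>e^((y + 1)x) + e^((y - 1)x)\<close> is \<open>2 cosh x\<close> times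
  \<open>e^(yx)\<close>, and \<open>cosh x\<close> cancels. The relation makes alternating sums of
  powers of odd numbers telescope.\<close>

lemma euler_sum_shift: "euler_sum r (y + 1) + euler_sum r (y - 1) = 2 * y ^ r"
proof -
  have "fps_exp (of_int (y + 1)) * euler_fps + fps_exp (of_int (y - 1)) * euler_fps
      = fps_exp (of_int y) * ((fps_exp 1 + fps_exp (- 1)) * euler_fps)"
    using fps_exp_add_mult[of "of_int y :: rat" 1] fps_exp_add_mult[of "of_int y :: rat" "- 1"]
    by (simp add: algebra_simps)
  also have "\<dots> = 2 * fps_exp (of_int y)" unfolding euler_fps_times_cosh by simp
  finally have "(of_int (euler_sum r (y + 1) + euler_sum r (y - 1)) :: rat) = fact r * fps_nth (2 * fps_exp (of_int y)) r"
    unfolding of_int_add[of "euler_sum r (y + 1)"] euler_sum_eq_fps_nth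
    by (simp only: fps_add_nth[symmetric] distrib_left[symmetric])
  also have "\<dots> = of_int (2 * y ^ r)" by (simp add: numeral_fps_const)
  finally show ?thesis by (simp only: of_int_eq_iff)
qed

lemma euler_number_odd: "odd n \<Longrightarrow> euler_number n = 0"
proof (induction n rule: less_induct)
  case (less n)
  have "euler_number n = - (\<Sum>k \<in> {k \<in> {1..n}. even k}. int (n choose k) * euler_number (n - k))"
    using less.prems by (subst euler_number.simps) auto
  also have "(\<Sum>k \<in> {k \<in> {1..n}. even k}. int (n choose k) * euler_number (n - k)) = 0"
    using less.prems by (intro sum.neutral) (auto intro!: less.IH)
  finally show ?case by simp
qed

text \<open>For even \<open>r\<close> only even powers of \<open>y\<close> survive, so the values at
  \<open>1\<close> and \<open>-1\<close> agree; their sum is \<open>2 * 0 ^ r = 0\<close>.\<close>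

lemma euler_sum_minus_1:
  assumes "even r" "r > 0"
  shows "euler_sum r (- 1) = 0"
proof -
  have "euler_sum r (- 1) = euler_sum r 1"
    unfolding euler_sum_def using assms(1)
    by (intro sum.cong refl) (auto simp: euler_number_odd uminus_power_if)
  then show ?thesis using euler_sum_shift[of r 0] assms(2) by simp
qed

text \<open>Telescoping of \<open>euler_sum_shift\<close> at \<open>y = 2m + 1\<close>; the boundary
  terms are the values at \<open>0\<close> and \<open>2n\<close>.\<close>

lemma alternating_odd_power_sum:
  "2 * (\<Sum>m<n. (- 1) ^ m * int (2 * m + 1) ^ r) = euler_number r - (- 1) ^ n * euler_sum r (int (2 * n))"
proof (induction n)
  case (Suc n)
  have "euler_sum r (int (2 * Suc n)) + euler_sum r (int (2 * n)) = 2 * int (2 * n + 1) ^ r"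
    using euler_sum_shift[of r "int (2 * n + 1)"] by (simp add: add_ac)
  then have "2 * ((- 1) ^ n * int (2 * n + 1) ^ r)
      = (- 1) ^ n * euler_sum r (int (2 * Suc n)) + (- 1) ^ n * euler_sum r (int (2 * n))"
    by (simp only: distrib_left[symmetric] mult.left_commute)
  then show ?case using Suc by (simp add: distrib_left)
qed simp

text \<open>Modulo \<open>2n + 1\<close> the boundary point \<open>2n\<close> is \<open>-1\<close>,
  where \<open>euler_sum\<close> vanishes.\<close>

lemma euler_number_cong:
  assumes "even r" "r > 0"
  shows "[2 * (\<Sum>m<n. (- 1) ^ m * int (2 * m + 1) ^ r) = euler_number r] (mod int (2 * n + 1))"
proof -
  have "[int (2 * n) = - 1] (mod int (2 * n + 1))"
    by (simp add: cong_iff_dvd_diff add.commute)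
  then have "[euler_sum r (int (2 * n)) = euler_sum r (- 1)] (mod int (2 * n + 1))"
    unfolding euler_sum_def by (intro cong_sum cong_mult cong_pow cong_refl)
  then have "[euler_number r - (- 1) ^ n * euler_sum r (int (2 * n)) = euler_number r - (- 1) ^ n * 0] (mod int (2 * n + 1))"
    unfolding euler_sum_minus_1[OF assms] by (intro cong_diff cong_mult cong_refl)
  then show ?thesis unfolding alternating_odd_power_sum by simp
qed

section \<open>Central binomial coefficients modulo a prime\<close>

lemma rising_prod_eq_binomial:
  "(of_nat ((N + k) choose k) :: rat) = (\<Prod>j=1..k. of_nat (N + j) / of_nat j)"
proof (induction k)
  case (Suc k)
  have "of_nat (Suc k) * (of_nat ((N + Suc k) choose Suc k) :: rat) = of_nat (N + Suc k) * of_nat ((N + k) choose k)"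
    using Suc_times_binomial[of k "N + k"] unfolding of_nat_mult[symmetric] of_nat_eq_iff
    by (simp del: binomial_Suc_Suc)
  then have "(of_nat ((N + Suc k) choose Suc k) :: rat) = of_nat ((N + k) choose k) * (of_nat (N + Suc k) / of_nat (Suc k))"
    by (simp add: field_simps del: of_nat_Suc binomial_Suc_Suc)
  then show ?case unfolding Suc.IH by simp
qed simp

lemma cbin_eq_prod: "cbin k = (\<Prod>j=1..k. 2 * of_nat (2 * j - 1) / of_nat j)"
proof (induction k)
  case (Suc k)
  have "cbin (Suc k) = cbin k * (2 * of_nat (2 * Suc k - 1) / of_nat (Suc k))"
    using cbin_Suc[of k] by (simp add: field_simps)
  then show ?case using Suc by simp
qed simp

context comm_monoid_set
begin

text \<open>Stated for \<open>comm_monoid_set\<close> to serve sums and products alike. The odd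
  indices appear as \<open>2n + 1 - 2j\<close>, later \<open>p - 2j\<close>.\<close>

lemma split_even_odd:
  fixes n :: nat
  shows "F g {1..2 * n} = F (\<lambda>j. g (2 * j)) {1..n} \<^bold>* F (\<lambda>j. g (2 * n + 1 - 2 * j)) {1..n}"
proof -
  have "F g {1..2 * n} = F (\<lambda>j. g (2 * j)) {1..n} \<^bold>* F (\<lambda>j. g (2 * j - 1)) {1..n}"
    by (induction n) (simp_all add: ac_simps)
  also have "F (\<lambda>j. g (2 * j - 1)) {1..n} = F (\<lambda>j. g (2 * n + 1 - 2 * j)) {1..n}"
    by (subst atLeastAtMost_rev) (simp add: algebra_simps)
  finally show ?thesis .
qed

lemma split_halves:
  fixes n :: nat
  shows "F g {1..2 * n} = F g {1..n} \<^bold>* F (\<lambda>j. g (2 * n + 1 - j)) {1..n}"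
proof -
  have "{1..2 * n} = {1..n} \<union> {n + 1..2 * n}" by auto
  then have "F g {1..2 * n} = F g {1..n} \<^bold>* F g {n + 1..2 * n}"
    by (simp only:) (rule union_disjoint, auto)
  also have "F g {n + 1..2 * n} = F (\<lambda>j. g (2 * n + 1 - j)) {1..n}"
    by (rule reindex_bij_witness[where i = "\<lambda>j. 2 * n + 1 - j" and j = "\<lambda>j. 2 * n + 1 - j"]) auto
  finally show ?thesis .
qed

end

definition inv_sq :: "nat \<Rightarrow> rat" where
  "inv_sq k = inverse (of_nat k ^ 2)"

section \<open>Units and congruences modulo \<open>p\<close>\<close>

locale odd_prime =
  fixes p n :: nat
  assumes prime: "prime p" and p_eq: "p = 2 * n + 1"
begin

lemma n_pos: "n > 0"
  using prime p_eq by (cases n) auto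

lemma of_nat_p: "(of_nat p :: rat) = 2 * of_nat n + 1"
  by (simp add: p_eq)

lemma unit: "\<not> p dvd k \<Longrightarrow> p_integral p (inverse (of_nat k))"
  using prime by (metis coprime_commute p_integral_inverse_of_nat prime_imp_coprime)

lemma unit_less: "0 < k \<Longrightarrow> k < p \<Longrightarrow> p_integral p (inverse (of_nat k))"
  by (rule unit) (auto dest: dvd_imp_le)

lemma unit_less_double:
  assumes "p < k" "k < 2 * p"
  shows "p_integral p (inverse (of_nat k))"
proof (rule unit)
  have "0 < k - p" "k - p < p" using assms by auto
  then have "\<not> p dvd k - p" by (auto dest: dvd_imp_le)
  then show "\<not> p dvd k" using assms by (auto simp: dvd_diff_nat)
qed

lemma unit_pow2: "p_integral p (inverse (2 ^ k))"
  using p_integral_power[OF unit_less[of 2], of k] n_pos unfolding p_eq by (simp add: power_inverse[symmetric])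

lemma p_integral_cbin [simp, intro]: "p_integral p (cbin k)"
  by (simp add: cbin_def)

lemma cong_of_int:
  "int p dvd a - b \<Longrightarrow> rat_cong p 1 (of_int a) (of_int b)"
  by (rule rat_cong_of_int) (simp add: cong_iff_dvd_diff)

lemma cong_fermat: "\<not> p dvd a \<Longrightarrow> rat_cong p 1 (of_nat a ^ (2 * n)) 1"
  using fermat_theorem[OF prime, of a] rat_cong_of_int[of "int a ^ (2 * n)" 1 p 1]
  by (simp add: p_eq flip: cong_int_iff)

text \<open>Neighbouring entries in row \<open>p - 1\<close> of the Pascal triangle add up to an
  inner entry of row \<open>p\<close>, which is divisible by \<open>p\<close>; so row
  \<open>p - 1\<close> alternates between \<open>1\<close> and \<open>-1\<close>.\<close>

lemma cong_cbin_n: "rat_cong p 1 (cbin n) ((-1) ^ n)"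
proof -
  have "[int ((2 * n) choose k) = (-1) ^ k] (mod int p)" if "k \<le> 2 * n" for k
    using that
  proof (induction k)
    case (Suc k)
    have "p dvd (p choose Suc k)" using Suc.prems prime p_eq by (intro dvd_choose_prime) auto
    then have "[int ((2 * n) choose k) + int ((2 * n) choose Suc k) = 0] (mod int p)"
      unfolding cong_0_iff of_nat_add[symmetric] int_dvd_int_iff by (simp add: p_eq)
    from cong_diff[OF this Suc.IH] show ?case using Suc.prems by simp
  qed simp
  from this[of n] show ?thesis
    using rat_cong_of_int[of "int ((2 * n) choose n)" "(-1) ^ n" p 1] by (simp add: cbin_def)
qed

text \<open>By the criterion of Euler both sides agree modulo \<open>p\<close>; they differ by at
  most 2 and \<open>p > 2\<close>, hence they are equal.\<close>

lemma Legendre_minus_1: "Legendre (- 1) (int p) = (-1) ^ n"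
proof -
  have "p > 2" using n_pos p_eq by simp
  then have c: "[Legendre (- 1) (int p) = (-1) ^ n] (mod int p)"
    using euler_criterion[of p "-1"] prime by (simp add: p_eq)
  have "Legendre (- 1) (int p) \<in> {- 1, 0, 1}" by (simp add: Legendre_def)
  moreover have "(- 1 :: int) ^ n \<in> {- 1, 1}" by (cases "even n") auto
  ultimately have "\<bar>Legendre (- 1) (int p) - (- 1) ^ n\<bar> < int p" using \<open>p > 2\<close> by auto
  with c have "Legendre (- 1) (int p) - (- 1) ^ n = 0"
    unfolding cong_iff_dvd_diff using zdvd_not_zless[of "\<bar>Legendre (- 1) (int p) - (- 1) ^ n\<bar>" "int p"] by (cases "Legendre (- 1) (int p) - (- 1) ^ n = 0") auto
  then show ?thesis by simp
qed

text \<open>The factor \<open>p\<close> sits in \<open>cbin (n + m + 1)\<close>. The induction works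
  because the quotient of consecutive terms is \<open>1\<close> modulo \<open>p\<close>.\<close>

lemma cong_cbin_product:
  assumes "m < n"
  shows "rat_cong p 1 (cbin (n - m) * cbin (n + m + 1) * of_nat (2 * m + 1) / of_nat p) 4"
  using assms
proof (induction m)
  case 0
  have u: "p_integral p (inverse (of_nat (n + 1)))"
    using n_pos by (intro unit_less) (auto simp: p_eq)
  \<comment> \<open>Here \<open>(n + 1) cbin (n + 1) = 2 p cbin n\<close>, and \<open>cbin n\<close>
    is a sign modulo \<open>p\<close>; then \<open>4 (n + 1) = 2p + 2\<close> gives the value
    \<open>4\<close>.\<close>
  have "of_nat (n + 1) * (cbin n * cbin (n + 1) / of_nat p) = 2 * cbin n ^ 2"
    using cbin_Suc[of n] of_nat_p n_pos by (simp add: field_simps power2_eq_square)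
  also have "rat_cong p 1 \<dots> (2 * ((- 1) ^ n) ^ 2)"
    by (intro rat_cong_mult rat_cong_power cong_cbin_n rat_cong_refl p_integral_numeral)
  also have "2 * ((- 1) ^ n) ^ 2 = (of_int 2 :: rat)" by (simp flip: power_mult)
  also have "rat_cong p 1 (of_int 2) (of_int (int (n + 1) * 4))"
    by (rule cong_of_int) (simp add: p_eq dvd_def, rule exI[of _ "- 2"], simp)
  finally have "rat_cong p 1 (of_nat (n + 1) * (cbin n * cbin (n + 1) / of_nat p)) (of_nat (n + 1) * 4)"
    by simp
  from rat_cong_mult_cancel[OF this u] show ?case by simp
next
  case (Suc m)
  define W where "W m = cbin (n - m) * cbin (n + m + 1) * of_nat (2 * m + 1) / (of_nat p :: rat)" for m
  \<comment> \<open>\<open>W (Suc m) / W m\<close> is \<open>a' b' c' / (a b c)\<close>; modulo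
    \<open>p\<close> both products are \<open>- (2m + 1) (2m + 2) (2m + 3)\<close>.\<close>
  define a b c where "a = (of_nat (p - 2 * m - 2) :: rat)" and "b = (of_nat (p + 2 * m + 3) :: rat)"
    and "c = (of_nat (2 * m + 1) :: rat)"
  define a' b' c' where "a' = (of_nat (p - 2 * m - 1) :: rat)" and "b' = (of_nat (p + 2 * m + 2) :: rat)"
    and "c' = (of_nat (2 * m + 3) :: rat)"
  have inv: "p_integral p (inverse a)" "p_integral p (inverse b)" "p_integral p (inverse c)"
    unfolding a_def b_def c_def
    by (intro unit_less unit_less_double; use Suc.prems p_eq in linarith)+
  have nz: "a \<noteq> 0" "b \<noteq> 0" "c \<noteq> 0"
    unfolding a_def b_def c_def of_nat_eq_0_iff using Suc.prems p_eq by auto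
  have "Suc (n - Suc m) = n - m" using Suc.prems by simp
  then have "of_nat (n - m) * cbin (n - m) = 2 * (2 * of_nat (n - Suc m) + 1) * cbin (n - Suc m)"
    using cbin_Suc[of "n - Suc m"] by simp
  then have 1: "a' * cbin (n - m) = 4 * a * cbin (n - Suc m)"
    using Suc.prems by (simp add: a_def a'_def p_eq of_nat_diff algebra_simps)
  have 2: "b * cbin (n + Suc m + 1) = 4 * b' * cbin (n + m + 1)"
    using cbin_Suc[of "n + m + 1"] by (simp add: b_def b'_def p_eq algebra_simps)
  have "4 * (a * b * c * W (Suc m)) = (4 * a * cbin (n - Suc m)) * (b * cbin (n + Suc m + 1)) * c * c' / of_nat p"
    by (simp add: W_def c'_def)
  also have "\<dots> = 4 * (a' * b' * c' * W m)"
    unfolding 1[symmetric] 2 by (simp add: W_def c_def)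
  finally have "a * b * c * W (Suc m) = a' * b' * c' * W m" by simp
  also have "rat_cong p 1 \<dots> (a' * b' * c' * 4)"
    using Suc by (intro rat_cong_mult rat_cong_refl) (auto simp: W_def a'_def b'_def c'_def)
  also have "rat_cong p 1 (a' * b' * c' * 4) (a * b * c * 4)"
  proof (intro rat_cong_mult[of _ _ _ _ 4 4])
    define q where "q = 2 * int m + 1"
    have "a' * b' * c' = of_int ((int p - q) * (int p + q + 1) * (q + 2))"
      "a * b * c = of_int ((int p - q - 1) * (int p + q + 2) * q)"
      using Suc.prems p_eq
      by (simp_all add: a'_def b'_def c'_def a_def b_def c_def q_def of_nat_diff) (simp_all add: algebra_simps)
    moreover have "(int p - q) * (int p + q + 1) * (q + 2) - (int p - q - 1) * (int p + q + 2) * q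
        = int p * (2 * int p + 2)"
      by (simp add: algebra_simps)
    ultimately show "rat_cong p 1 (a' * b' * c') (a * b * c)"
      by (metis cong_of_int dvd_triv_left)
  qed auto
  finally have "rat_cong p 1 (a * b * c * W (Suc m)) (a * b * c * 4)" .
  from rat_cong_mult_cancel[OF this] have "rat_cong p 1 (W (Suc m)) 4"
    using inv nz by (auto simp: inverse_mult_distrib)
  then show ?case by (simp add: W_def)
qed

section \<open>Inverse squares, and the congruences of Morley and Wolstenholme\<close>

lemma p_integral_inv_sq: "0 < k \<Longrightarrow> k < p \<Longrightarrow> p_integral p (inv_sq k)"
  using p_integral_power[OF unit_less] by (simp add: inv_sq_def power_inverse[symmetric])

lemma cong_inv_sq_minus:
  assumes "0 < k" "k < p"
  shows "rat_cong p 1 (inv_sq (p - k)) (inv_sq k)"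
proof -
  have "rat_cong p 1 (of_int (int p - int k)) (of_int (- int k))"
    by (rule cong_of_int) simp
  from rat_cong_power[OF this, of 2] have "rat_cong p 1 (of_nat (p - k) ^ 2) (of_nat k ^ 2)"
    using assms by (simp add: of_nat_diff)
  then show ?thesis
    unfolding inv_sq_def using assms p_integral_inv_sq[of k] p_integral_inv_sq[of "p - k"]
    by (intro rat_cong_inverse) (auto simp: inv_sq_def)
qed

text \<open>Let \<open>H\<close> be the first sum. Modulo \<open>p\<close>, the sum of inverse
  squares over \<open>1..p - 1\<close> is \<open>8 H\<close> when split into halves and
  \<open>2 H\<close> when split by parity. So \<open>6 H\<close> vanishes, and 6 is a unit for
  \<open>p > 3\<close>.\<close>

lemma sum_inv_sq:
  assumes "p \<noteq> 3"
  shows "rat_cong p 1 (\<Sum>j=1..n. inv_sq (2 * j)) 0" "rat_cong p 1 (\<Sum>j=1..n. inv_sq (p - 2 * j)) 0"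
proof -
  define H where "H = (\<Sum>j=1..n. inv_sq (2 * j))"
  have H4: "(\<Sum>j=1..n. inv_sq j) = 4 * H"
    unfolding H_def sum_distrib_left by (intro sum.cong refl) (simp add: inv_sq_def power_mult_distrib)
  have int: "p_integral p H" "p_integral p (4 * H)"
    unfolding H_def
    by (intro p_integral_mult p_integral_sum p_integral_inv_sq p_integral_numeral; use p_eq in auto)+
  have H': "rat_cong p 1 (\<Sum>j=1..n. inv_sq (p - 2 * j)) H"
    unfolding H_def by (intro rat_cong_sum cong_inv_sq_minus) (auto simp: p_eq)
  have "rat_cong p 1 (\<Sum>j=1..n. inv_sq (p - j)) (\<Sum>j=1..n. inv_sq j)"
    by (intro rat_cong_sum cong_inv_sq_minus) (auto simp: p_eq)
  then have "rat_cong p 1 ((\<Sum>j=1..n. inv_sq j) + (\<Sum>j=1..n. inv_sq (p - j))) (4 * H + 4 * H)"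
    unfolding H4 by (intro rat_cong_add rat_cong_refl int)
  moreover have "rat_cong p 1 (H + (\<Sum>j=1..n. inv_sq (p - 2 * j))) (H + H)"
    by (intro rat_cong_add rat_cong_refl int H')
  moreover have "(\<Sum>j=1..n. inv_sq j) + (\<Sum>j=1..n. inv_sq (p - j)) = H + (\<Sum>j=1..n. inv_sq (p - 2 * j))"
    using sum.split_halves[of inv_sq n] sum.split_even_odd[of inv_sq n] by (simp add: p_eq H_def)
  ultimately have "rat_cong p 1 (4 * H + 4 * H) (H + H)"
    by (metis rat_cong_sym rat_cong_trans)
  from rat_cong_diff[OF this rat_cong_refl[of p "H + H"]] have "rat_cong p 1 (of_nat 2 * (of_nat 3 * H)) (of_nat 2 * (of_nat 3 * 0))"
    using int p_integral_mult[OF p_integral_numeral int(1), of "num.Bit0 num.One"] by simp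
  moreover have "p > 3" using assms n_pos p_eq by (cases "n = 1") auto
  ultimately have "rat_cong p 1 H 0"
    using unit_less[of 2] unit_less[of 3]
    by (elim rat_cong_mult_cancel[THEN rat_cong_mult_cancel]) auto
  then show "rat_cong p 1 (\<Sum>j=1..n. inv_sq (2 * j)) 0" "rat_cong p 1 (\<Sum>j=1..n. inv_sq (p - 2 * j)) 0"
    using H' by (auto simp: H_def intro: rat_cong_trans)
qed

text \<open>Products of two or more of the subtracted terms are divisible by
  \<open>p ^ 4\<close>.\<close>

lemma cong_prod_one_minus:
  assumes "finite A" "\<And>j. j \<in> A \<Longrightarrow> p_integral p (a j)"
  shows "rat_cong p 4 (\<Prod>j\<in>A. 1 - of_nat p ^ 2 * a j) (1 - of_nat p ^ 2 * (\<Sum>j\<in>A. a j))"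
  using assms
proof (induction A rule: finite_induct)
  case (insert x A)
  have "rat_cong p 4 ((1 - of_nat p ^ 2 * a x) * (\<Prod>j\<in>A. 1 - of_nat p ^ 2 * a j))
     ((1 - of_nat p ^ 2 * a x) * (1 - of_nat p ^ 2 * (\<Sum>j\<in>A. a j)))"
    using insert by (intro rat_cong_mult rat_cong_refl) auto
  also have "rat_cong p 4 \<dots> (1 - of_nat p ^ 2 * (\<Sum>j\<in>insert x A. a j))"
  proof (rule rat_congI)
    show "p_integral p (1 - of_nat p ^ 2 * (\<Sum>j\<in>insert x A. a j))" "p_integral p (a x * (\<Sum>j\<in>A. a j))"
      using insert.prems by auto
    show "(1 - of_nat p ^ 2 * a x) * (1 - of_nat p ^ 2 * (\<Sum>j\<in>A. a j)) - (1 - of_nat p ^ 2 * (\<Sum>j\<in>insert x A. a j))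
        = of_nat p ^ 4 * (a x * (\<Sum>j\<in>A. a j))"
      using insert.hyps by (simp add: algebra_simps power2_eq_square power4_eq_xxxx)
  qed
  finally show ?case using insert by simp
qed simp

lemma cong_prod_one_minus':
  assumes "finite A" "\<And>j. j \<in> A \<Longrightarrow> p_integral p (a j)" "rat_cong p 1 (\<Sum>j\<in>A. a j) 0"
  shows "rat_cong p 3 (\<Prod>j\<in>A. 1 - of_nat p ^ 2 * a j) 1"
proof -
  have "rat_cong p 3 (\<Prod>j\<in>A. 1 - of_nat p ^ 2 * a j) (1 - of_nat p ^ 2 * (\<Sum>j\<in>A. a j))"
    using cong_prod_one_minus[OF assms(1,2)] by (rule rat_cong_mono) auto
  also have "rat_cong p 3 \<dots> (1 - of_nat p ^ 2 * 0)"
    using rat_cong_scale[OF assms(3), of 2] by (intro rat_cong_diff rat_cong_refl) auto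
  finally show ?thesis by simp
qed

text \<open>Reflecting \<open>j\<close> in \<open>1..n\<close> turns the factors
  \<open>2j - 1\<close> and \<open>n + j\<close> into \<open>p - 2j\<close> and
  \<open>p - j\<close>. Comparing the two forms gives the product identities below.\<close>

lemma cbin_n_eq_prod:
  "cbin n = (\<Prod>j=1..n. 2 * of_nat (p - 2 * j) / of_nat j)" "cbin n = (\<Prod>j=1..n. of_nat (p - j) / of_nat j)"
proof -
  have "(\<Prod>j=1..n. of_nat (2 * j - 1) :: rat) = (\<Prod>j=1..n. of_nat (p - 2 * j))"
    by (subst prod.atLeastAtMost_rev) (simp add: p_eq algebra_simps)
  then show "cbin n = (\<Prod>j=1..n. 2 * of_nat (p - 2 * j) / of_nat j)"
    by (simp only: cbin_eq_prod prod_dividef prod.distrib)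
  have "(\<Prod>j=1..n. of_nat (n + j) :: rat) = (\<Prod>j=1..n. of_nat (p - j))"
    by (subst prod.atLeastAtMost_rev) (intro prod.cong refl, auto simp: p_eq)
  then show "cbin n = (\<Prod>j=1..n. of_nat (p - j) / of_nat j)"
    unfolding cbin_def mult_2 rising_prod_eq_binomial by (simp add: prod_dividef)
qed

text \<open>With \<open>z = p - 2j\<close> one has \<open>1 - p^2 / z^2 = -4j (p - j) / z^2\<close>.
  So the square of the first form of \<open>cbin n\<close>, times the product, is the second form
  with a factor \<open>-16\<close> for each \<open>j\<close>.\<close>

lemma cbin_n_times_prod:
  "cbin n * (\<Prod>j=1..n. 1 - of_nat p ^ 2 * inv_sq (p - 2 * j)) = (- 16) ^ n"
proof -
  have "cbin n * (cbin n * (\<Prod>j=1..n. 1 - of_nat p ^ 2 * inv_sq (p - 2 * j)))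
     = (\<Prod>j=1..n. (2 * of_nat (p - 2 * j) / of_nat j) * ((2 * of_nat (p - 2 * j) / of_nat j) * (1 - of_nat p ^ 2 * inv_sq (p - 2 * j))))"
    unfolding prod.distrib cbin_n_eq_prod(1)[symmetric] ..
  also have "\<dots> = (\<Prod>j=1..n. - 16 * (of_nat (p - j) / of_nat j))"
  proof (rule prod.cong)
    fix j assume j: "j \<in> {1..n}"
    have key: "x / y * (x / y * (1 - P\<^sup>2 * inverse (z\<^sup>2))) = - 16 * (u / y)"
      if "y \<noteq> 0" "z \<noteq> 0" "x = 2 * z" "P = z + 2 * y" "u = z + y" for x y z P u :: rat
      using that(1,2) unfolding that(3-5) by (simp add: field_simps power2_eq_square)
    show "(2 * of_nat (p - 2 * j) / of_nat j) * ((2 * of_nat (p - 2 * j) / of_nat j) * (1 - of_nat p ^ 2 * inv_sq (p - 2 * j)))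
        = - 16 * (of_nat (p - j) / of_nat j :: rat)"
      unfolding inv_sq_def by (rule key) (use j in \<open>auto simp: of_nat_diff p_eq\<close>)
  qed simp
  also have "\<dots> = (- 16) ^ n * cbin n"
    unfolding prod.distrib cbin_n_eq_prod(2)[symmetric] by simp
  finally show ?thesis using cbin_pos[of n] by simp
qed

text \<open>\<open>cbin p\<close> is twice the product of \<open>(p + k) / k\<close> for
  \<open>0 < k < p\<close>, split into \<open>k = 2j\<close> and \<open>k = p - 2j\<close>.
  Multiplied by the square of \<open>cbin n\<close>, each factor becomes
  \<open>-16 (p - j) / j\<close> times \<open>1 - p^2 / (2j)^2\<close>.\<close>

lemma cbin_p_times_cbin_n:
  "cbin p * cbin n = 2 * (- 16) ^ n * (\<Prod>j=1..n. 1 - of_nat p ^ 2 * inv_sq (2 * j))"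
proof -
  have "p * ((2 * p) choose p) = p * (2 * ((p + 2 * n) choose (2 * n)))"
    using Suc_times_binomial[of "2 * n" "p + 2 * n"] by (simp add: p_eq del: binomial_Suc_Suc)
  then have "(2 * p) choose p = 2 * ((p + 2 * n) choose (2 * n))"
    using prime_gt_0_nat[OF prime] by (simp only: nat_mult_eq_cancel1)
  then have "cbin p = 2 * of_nat ((p + 2 * n) choose (2 * n))" by (simp add: cbin_def)
  also have "of_nat ((p + 2 * n) choose (2 * n)) = (\<Prod>j=1..n. of_nat (p + 2 * j) / of_nat (2 * j))
      * (\<Prod>j=1..n. of_nat (p + (p - 2 * j)) / of_nat (p - 2 * j) :: rat)"
    unfolding rising_prod_eq_binomial by (subst prod.split_even_odd) (simp only: p_eq)
  finally have "(cbin p * cbin n) * cbin n = 2 * (\<Prod>j=1..n. of_nat (p + 2 * j) / of_nat (2 * j)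
      * (of_nat (p + (p - 2 * j)) / of_nat (p - 2 * j))
      * (2 * of_nat (p - 2 * j) / of_nat j) * (2 * of_nat (p - 2 * j) / of_nat j))"
    unfolding prod.distrib cbin_n_eq_prod(1)[symmetric] by simp
  also have "\<dots> = 2 * (\<Prod>j=1..n. - 16 * (1 - of_nat p ^ 2 * inv_sq (2 * j)) * (of_nat (p - j) / of_nat j))"
  proof (rule arg_cong[where f = "\<lambda>x. 2 * x"], rule prod.cong)
    fix j assume j: "j \<in> {1..n}"
    have key: "a / b * (c / z) * (2 * z / y) * (2 * z / y) = - 16 * (1 - P\<^sup>2 * inverse (b\<^sup>2)) * (u / y)"
      if "y \<noteq> 0" "z \<noteq> 0" "a = z + 4 * y" "b = 2 * y" "c = 2 * u" "P = z + 2 * y" "u = z + y" for a b c y z P u :: rat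
      using that(1,2) unfolding that(5) unfolding that(3,4,6,7) by (simp add: field_simps power2_eq_square)
    show "of_nat (p + 2 * j) / of_nat (2 * j) * (of_nat (p + (p - 2 * j)) / of_nat (p - 2 * j))
      * (2 * of_nat (p - 2 * j) / of_nat j) * (2 * of_nat (p - 2 * j) / of_nat j)
      = - 16 * (1 - of_nat p ^ 2 * inv_sq (2 * j)) * (of_nat (p - j) / of_nat j :: rat)"
      unfolding inv_sq_def by (rule key) (use j in \<open>auto simp: of_nat_diff p_eq\<close>)
  qed simp
  also have "\<dots> = 2 * (- 16) ^ n * (\<Prod>j=1..n. 1 - of_nat p ^ 2 * inv_sq (2 * j)) * cbin n"
    unfolding prod.distrib cbin_n_eq_prod(2)[symmetric] by simp
  finally show ?thesis using cbin_pos[of n] by simp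
qed

section \<open>The truncated sum modulo \<open>p ^ 4\<close>\<close>

text \<open>Fermat, with \<open>2n - 2 = p - 3\<close>: this exponent becomes the index of the Euler
  number.\<close>

lemma cong_inv_sq:
  assumes "0 < k" "k < p"
  shows "rat_cong p 1 (inv_sq k) (of_nat k ^ (2 * n - 2))"
proof -
  have "\<not> p dvd k" using assms by (auto dest: dvd_imp_le)
  have "of_nat k ^ 2 * inv_sq k = 1" using assms by (simp add: inv_sq_def)
  also have "rat_cong p 1 1 (of_nat k ^ (2 * n))"
    by (rule rat_cong_sym) (rule cong_fermat, fact)
  also have "of_nat k ^ (2 * n) = (of_nat k ^ 2 * of_nat k ^ (2 * n - 2) :: rat)"
    using n_pos by (cases n) (simp_all add: power2_eq_square)
  finally show ?thesis
    by (rule rat_cong_mult_cancel) (use p_integral_inv_sq[OF assms] assms in \<open>auto simp: inv_sq_def\<close>)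
qed

lemma cong_pow2: "rat_cong p 1 (2 ^ (2 * n)) 1"
proof -
  have "\<not> p dvd 2" using n_pos p_eq by (auto dest: dvd_imp_le)
  then show ?thesis using cong_fermat[of 2] by simp
qed

lemma cong_inverse_pow2: "rat_cong p 1 (inverse (2 ^ (8 * n + 1))) (inverse 2)"
proof -
  have "2 ^ (8 * n + 1) * inverse 2 = ((2 :: rat) ^ (2 * n)) ^ 4"
    by (simp flip: power_mult)
  also have "rat_cong p 1 \<dots> (1 ^ 4)" by (rule rat_cong_power[OF cong_pow2])
  also have "1 ^ 4 = 2 ^ (8 * n + 1) * inverse ((2 :: rat) ^ (8 * n + 1))" by simp
  finally have "rat_cong p 1 (2 ^ (8 * n + 1) * inverse 2) (2 ^ (8 * n + 1) * inverse (2 ^ (8 * n + 1)))" .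
  from rat_cong_sym[OF rat_cong_mult_cancel[OF this unit_pow2]] show ?thesis by simp
qed

text \<open>Modulo \<open>p ^ 3\<close>, \<open>cbin n\<close> is \<open>(-16)^n\<close> and
  \<open>cbin p * cbin n\<close> is \<open>2 (-16)^n\<close>; the product of these two values is the
  denominator \<open>2 ^ (8n + 1)\<close>.\<close>

lemma cong_last_term:
  assumes "p \<noteq> 3"
  shows "rat_cong p 3 (cbin n ^ 2 / 2 ^ (8 * n + 1) * cbin p) 1"
proof -
  define A B where "A = (\<Prod>j=1..n. 1 - of_nat p ^ 2 * inv_sq (2 * j))"
    and "B = (\<Prod>j=1..n. 1 - of_nat p ^ 2 * inv_sq (p - 2 * j))"
  have A: "rat_cong p 3 A 1" unfolding A_def
    by (intro cong_prod_one_minus' sum_inv_sq assms p_integral_inv_sq) (auto simp: p_eq)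
  have B: "rat_cong p 3 B 1" unfolding B_def
    by (intro cong_prod_one_minus' sum_inv_sq assms p_integral_inv_sq) (auto simp: p_eq)
  have "rat_cong p 3 (cbin n * 1) (cbin n * B)"
    by (intro rat_cong_mult rat_cong_refl rat_cong_sym[OF B]) auto
  then have G: "rat_cong p 3 (cbin n) ((- 16) ^ n)"
    unfolding B_def cbin_n_times_prod mult_1_right .
  have "cbin n ^ 2 / 2 ^ (8 * n + 1) * cbin p = cbin n * (cbin p * cbin n) * inverse (2 ^ (8 * n + 1))"
    by (simp only: power2_eq_square divide_inverse mult_ac)
  also have "\<dots> = cbin n * (2 * (- 16) ^ n * A) * inverse (2 ^ (8 * n + 1))"
    by (simp only: cbin_p_times_cbin_n A_def)
  also have "rat_cong p 3 \<dots> ((- 16) ^ n * (2 * (- 16) ^ n * 1) * inverse (2 ^ (8 * n + 1)))"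
    by (intro rat_cong_mult G A rat_cong_refl p_integral_mult unit_pow2 p_integral_power p_integral_minus) auto
  also have "(- 16) ^ n * (2 * (- 16) ^ n * 1) = (2 :: rat) ^ (8 * n + 1)"
    using power_mult[of "2 :: rat" 8 n] by (simp flip: power_mult_distrib)
  finally show ?thesis by simp
qed

lemma cong_truncated_sum:
  assumes "p \<noteq> 3"
  shows "rat_cong p 4 (\<Sum>k=0..n. of_nat (4 * k + 1) * cbin k ^ 3 / (-64) ^ k)
    (of_nat p * (- 1) ^ n + of_nat p ^ 3 * of_int (euler_number (p - 3)))"
proof -
  define K where "K = cbin n ^ 2 * inverse (2 ^ (8 * n + 1))"
  define Q where "Q m = (- 1) ^ m * cbin (n - m) * cbin (n + m + 1) / of_nat (2 * m + 1)" for m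
  define W where "W m = cbin (n - m) * cbin (n + m + 1) * of_nat (2 * m + 1) / of_nat p" for m
  have "n > 1" using assms n_pos p_eq by (cases "n = 1") auto
  have "rat_cong p 1 (cbin n ^ 2) (((- 1) ^ n) ^ 2)"
    by (rule rat_cong_power[OF cong_cbin_n])
  also have "((- 1) ^ n) ^ 2 = (1 :: rat)" by (simp flip: power_mult)
  finally have "rat_cong p 1 K (1 * inverse 2)"
    unfolding K_def by (rule rat_cong_mult[OF _ cong_inverse_pow2])
  \<comment> \<open>Modulo \<open>p\<close>, \<open>K\<close> is \<open>1/2\<close> and
    \<open>W m\<close> is \<open>4\<close>, which leaves the factor 2 that
    \<open>euler_number_cong\<close> expects.\<close>
  then have "rat_cong p 1 (K * ((- 1) ^ m * W m * inv_sq (2 * m + 1)))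
      (1 * inverse 2 * ((- 1) ^ m * 4 * of_nat (2 * m + 1) ^ (2 * n - 2)))" if "m < n" for m
    using that p_eq unfolding W_def
    by (intro rat_cong_mult cong_cbin_product cong_inv_sq rat_cong_refl p_integral_power p_integral_minus) auto
  then have "rat_cong p 1 (\<Sum>m<n. K * ((- 1) ^ m * W m * inv_sq (2 * m + 1)))
      (\<Sum>m<n. 1 * inverse 2 * ((- 1) ^ m * 4 * of_nat (2 * m + 1) ^ (2 * n - 2)))"
    by (intro rat_cong_sum) auto
  also have "(\<Sum>m<n. 1 * inverse 2 * ((- 1) ^ m * 4 * of_nat (2 * m + 1) ^ (2 * n - 2)))
      = (of_int (2 * (\<Sum>m<n. (- 1) ^ m * int (2 * m + 1) ^ (2 * n - 2))) :: rat)"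
    by (simp add: sum_distrib_left)
  also have "rat_cong p 1 \<dots> (of_int (euler_number (p - 3)))"
    using euler_number_cong[of "2 * n - 2" n] \<open>n > 1\<close> by (intro rat_cong_of_int) (simp add: p_eq)
  finally have E: "rat_cong p 1 (\<Sum>m<n. K * ((- 1) ^ m * W m * inv_sq (2 * m + 1))) (of_int (euler_number (p - 3)))" .
  have "(\<Sum>k=0..n. of_nat (4 * k + 1) * cbin k ^ 3 / (-64) ^ k) = (\<Sum>m=0..n. of_nat p ^ 2 * K * Q m)"
    unfolding binomial_cube_sum[of n] p_eq[symmetric] sum_distrib_left K_def Q_def
    by (simp only: divide_inverse mult.assoc)
  also have "\<dots> = of_nat p ^ 2 * K * Q n + (\<Sum>m<n. of_nat p ^ 2 * K * Q m)"
    by (simp add: atLeast0AtMost lessThan_Suc_atMost[symmetric])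
  \<comment> \<open>For \<open>m = n\<close> the denominator \<open>2m + 1\<close> is
    \<open>p\<close> and removes one of the two factors \<open>p\<close>, so this term has to be
    known modulo \<open>p ^ 3\<close>.\<close>
  also have "of_nat p ^ 2 * K * Q n = of_nat p ^ 1 * ((- 1) ^ n * (cbin n ^ 2 / 2 ^ (8 * n + 1) * cbin p))"
  proof -
    have "P\<^sup>2 * (C * inverse E) * (e * 1 * u / P) = P ^ 1 * (e * (C / E * u))" if "P \<noteq> 0" for P C E e u :: rat
      using that by (simp add: power2_eq_square divide_inverse)
    moreover have "n + n + 1 = p" "2 * n + 1 = p" "of_nat p \<noteq> (0 :: rat)" using p_eq by simp_all
    ultimately show ?thesis unfolding K_def Q_def by (simp only: diff_self_eq_0 cbin_0 not_False_eq_True)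
  qed
  \<comment> \<open>For \<open>m < n\<close> the factor \<open>p\<close> in
    \<open>cbin (n + m + 1)\<close> is taken out too, so the rest matters only modulo
    \<open>p\<close>.\<close>
  also have "(\<Sum>m<n. of_nat p ^ 2 * K * Q m) = of_nat p ^ 3 * (\<Sum>m<n. K * ((- 1) ^ m * W m * inv_sq (2 * m + 1)))"
    unfolding sum_distrib_left
  proof (rule sum.cong)
    fix m
    have "P\<^sup>2 * K * (e * u * v / q) = P ^ 3 * (K * (e * (u * v * q / P) * inverse (q\<^sup>2)))"
      if "P \<noteq> 0" "q \<noteq> 0" for P q e u v :: rat
      using that by (simp add: field_simps power2_eq_square power3_eq_cube)
    then show "of_nat p ^ 2 * K * Q m = of_nat p ^ 3 * (K * ((- 1) ^ m * W m * inv_sq (2 * m + 1)))"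
      unfolding Q_def W_def inv_sq_def by (simp add: p_eq)
  qed simp
  also have "rat_cong p 4 (of_nat p ^ 1 * ((- 1) ^ n * (cbin n ^ 2 / 2 ^ (8 * n + 1) * cbin p)) + \<dots>)
      (of_nat p ^ 1 * ((- 1) ^ n * 1) + of_nat p ^ 3 * of_int (euler_number (p - 3)))"
  proof (rule rat_cong_add)
    have "rat_cong p 3 ((- 1) ^ n * (cbin n ^ 2 / 2 ^ (8 * n + 1) * cbin p)) ((- 1) ^ n * 1)"
      by (intro rat_cong_mult cong_last_term assms rat_cong_refl p_integral_power p_integral_minus p_integral_1)
    from rat_cong_scale[OF this, of 1]
    show "rat_cong p 4 (of_nat p ^ 1 * ((- 1) ^ n * (cbin n ^ 2 / 2 ^ (8 * n + 1) * cbin p)))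
        (of_nat p ^ 1 * ((- 1) ^ n * 1))" by simp
  qed (use rat_cong_scale[OF E, of 3] in simp)
  finally show ?thesis by simp
qed

section \<open>Cancellation of the terms with \<open>n < k < p\<close>\<close>

text \<open>For \<open>n < k < p\<close> the prime \<open>p\<close> divides \<open>cbin k\<close>.
  The power \<open>4 ^ k\<close> makes the ratio of neighbours \<open>(2k + 1) / (2k + 2)\<close>,
  and its cube is \<open>(-64) ^ k\<close> up to sign.\<close>

definition scaled_cbin :: "nat \<Rightarrow> rat" where
  "scaled_cbin k = cbin k / 4 ^ k / of_nat p"

lemma scaled_cbin_Suc: "of_nat (2 * k + 2) * scaled_cbin (Suc k) = of_nat (2 * k + 1) * scaled_cbin k"
proof -
  have "of_nat (2 * k + 2) * cbin (Suc k) = 4 * (of_nat (2 * k + 1) * cbin k)"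
    using cbin_Suc[of k] by (simp add: algebra_simps)
  moreover have "a * (c / (4 * E) / P) = b * (d / E / P)" if "a * c = 4 * (b * d)" for a b c d E P :: rat
    using that by simp
  ultimately show ?thesis unfolding scaled_cbin_def power_Suc by blast
qed

text \<open>The indices add up to \<open>3n + 1\<close>. Induction from the two ends
  \<open>2n\<close> and \<open>n + 1\<close> inwards: modulo \<open>p\<close> both sides are
  multiplied by the same ratio.\<close>

lemma scaled_cbin_reflect:
  assumes "i < n"
  shows "rat_cong p 1 (scaled_cbin (2 * n - i)) ((- 1) ^ (n + 1) * scaled_cbin (n + 1 + i))"
  using assms
proof (induction i)
  case 0
  have pow4: "(4 :: rat) ^ n = 2 ^ (2 * n)" by (simp add: power_mult[of _ 2 n])
  have "rat_cong p 1 (scaled_cbin (2 * n)) (- 1)"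
  proof (rule rat_cong_mult_cancel)
    \<comment> \<open>\<open>cong_cbin_product\<close> at \<open>m = n - 1\<close> gives
      \<open>4\<close> for \<open>?u * scaled_cbin (2n)\<close>, while \<open>?u\<close> itself is
      \<open>-4\<close> by Fermat.\<close>
    let ?u = "of_nat (p - 2) * 2 * 2 ^ (4 * n) :: rat"
    have "p - 2 \<noteq> 0" using n_pos p_eq by simp
    then show "?u \<noteq> 0" by (simp only: of_nat_eq_0_iff mult_eq_0_iff power_not_zero) simp
    have "p_integral p (inverse (of_nat (p - 2)))"
      by (rule unit_less) (use n_pos p_eq in auto)
    then show "p_integral p (inverse ?u)"
      unfolding inverse_mult_distrib using unit_pow2[of 1] by (intro p_integral_mult unit_pow2) simp_all
    have eqs: "n - (n - 1) = 1" "n + (n - 1) + 1 = 2 * n" "2 * (n - 1) + 1 = p - 2"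
      using n_pos p_eq by auto
    have "rat_cong p 1 (cbin 1 * cbin (2 * n) * of_nat (p - 2) / of_nat p) 4"
      using cong_cbin_product[of "n - 1"] n_pos unfolding eqs by simp
    moreover have "cbin 1 = 2" using cbin_Suc[of 0] by simp
    moreover have "(4 :: rat) ^ (2 * n) = 2 ^ (4 * n)"
      using power_mult[of "2 :: rat" 2 "2 * n"] by simp
    ultimately have "rat_cong p 1 (?u * scaled_cbin (2 * n)) 4"
      by (simp add: scaled_cbin_def mult_ac)
    moreover have "rat_cong p 1 (?u * - 1) (- 2 * 2 * (1 ^ 2) * - 1)"
    proof (intro rat_cong_mult rat_cong_refl)
      show "rat_cong p 1 (of_nat (p - 2)) (- 2)"
        using cong_of_int[of "int p - 2" "- 2"] n_pos by (simp add: p_eq of_nat_diff)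
      show "rat_cong p 1 (2 ^ (4 * n)) (1 ^ 2)"
        using rat_cong_power[OF cong_pow2, of 2] by (simp flip: power_mult)
    qed (auto intro: p_integral_minus)
    ultimately show "rat_cong p 1 (?u * scaled_cbin (2 * n)) (?u * - 1)"
      by (elim rat_cong_trans[OF _ rat_cong_sym]) simp
  qed
  moreover have "rat_cong p 1 (scaled_cbin (n + 1)) ((- 1) ^ n)"
  proof (rule rat_cong_mult_cancel)
    \<comment> \<open>Here \<open>?u * scaled_cbin (n + 1)\<close> is exactly
      \<open>2 cbin n\<close>, while \<open>?u\<close> is \<open>2\<close> modulo
      \<open>p\<close>.\<close>
    let ?u = "of_nat (n + 1) * 4 * 2 ^ (2 * n) :: rat"
    show "?u \<noteq> 0" by (simp del: of_nat_Suc)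
    have "p_integral p (inverse (of_nat (n + 1)))"
      by (rule unit_less) (use n_pos p_eq in auto)
    then show "p_integral p (inverse ?u)"
      unfolding inverse_mult_distrib using unit_pow2[of 2] by (intro p_integral_mult unit_pow2) simp_all
    have "?u * scaled_cbin (n + 1) = of_nat (n + 1) * cbin (n + 1) / of_nat p"
    proof -
      have "a * 4 * E * (C / (E * 4) / P) = a * C / P" if "E \<noteq> 0" for a C E P :: rat
        using that by simp
      moreover have "(4 :: rat) ^ (n + 1) = 2 ^ (2 * n) * 4" by (simp add: pow4)
      moreover have "(2 :: rat) ^ (2 * n) \<noteq> 0" by simp
      ultimately show ?thesis unfolding scaled_cbin_def by (simp only: not_False_eq_True)
    qed
    also have "\<dots> = 2 * cbin n"
    proof -
      have "of_nat (n + 1) * cbin (n + 1) = of_nat p * (2 * cbin n)"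
        using cbin_Suc[of n] of_nat_p by simp
      then show ?thesis by (simp add: p_eq del: of_nat_Suc of_nat_add)
    qed
    also have "rat_cong p 1 \<dots> (2 * (- 1) ^ n)"
      by (intro rat_cong_mult cong_cbin_n rat_cong_refl) auto
    also have "2 * (- 1) ^ n = 2 * 1 * (- 1 :: rat) ^ n" by simp
    also have "rat_cong p 1 \<dots> (?u * (- 1) ^ n)"
    proof (intro rat_cong_mult rat_cong_refl)
      show "rat_cong p 1 2 (of_nat (n + 1) * 4)"
        using cong_of_int[of 2 "int (n + 1) * 4"] by (simp add: p_eq dvd_def) (simp add: exI[of _ "- 2"])
      show "rat_cong p 1 1 (2 ^ (2 * n))" by (rule rat_cong_sym[OF cong_pow2])
    qed (auto intro: p_integral_minus)
    finally show "rat_cong p 1 (?u * scaled_cbin (n + 1)) (?u * (- 1) ^ n)" .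
  qed
  then have "rat_cong p 1 ((- 1) ^ (n + 1) * scaled_cbin (n + 1)) ((- 1) ^ (n + 1) * (- 1) ^ n)"
    by (intro rat_cong_mult rat_cong_refl p_integral_power p_integral_minus p_integral_1)
  moreover have "(- 1 :: rat) ^ (n + 1) * (- 1) ^ n = - 1" by (simp flip: power_add)
  ultimately show ?case by (auto intro: rat_cong_trans dest: rat_cong_sym)
next
  case (Suc i)
  define s where "s = (- 1 :: rat) ^ (n + 1)"
  \<comment> \<open>The ratios are \<open>a' / a\<close> on the left and \<open>b' / b\<close> on
    the right; \<open>a' b\<close> and \<open>a b'\<close> are both
    \<open>- (2i + 2) (2i + 3)\<close> modulo \<open>p\<close>.\<close>
  define a b where "a = (of_nat (2 * p - 3 - 2 * i) :: rat)" and "b = (of_nat (p + 3 + 2 * i) :: rat)"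
  define a' b' where "a' = (of_nat (2 * p - 2 - 2 * i) :: rat)" and "b' = (of_nat (p + 2 + 2 * i) :: rat)"
  have inv: "p_integral p (inverse a)" "p_integral p (inverse b)"
    unfolding a_def b_def
    by (intro unit_less_double; use Suc.prems p_eq in linarith)+
  have nz: "a \<noteq> 0" "b \<noteq> 0"
    unfolding a_def b_def of_nat_eq_0_iff using Suc.prems p_eq by auto
  define k where "k = 2 * n - Suc i"
  have "2 * n - i = Suc k" using Suc.prems by (simp add: k_def)
  moreover have "2 * k + 1 = 2 * p - 3 - 2 * i" "2 * k + 2 = 2 * p - 2 - 2 * i"
    using Suc.prems p_eq by (auto simp: k_def)
  ultimately have 1: "a * scaled_cbin (2 * n - Suc i) = a' * scaled_cbin (2 * n - i)"
    using scaled_cbin_Suc[of k] by (simp add: a_def a'_def k_def[symmetric])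
  have "2 * (n + 1 + i) + 2 = p + 3 + 2 * i" "2 * (n + 1 + i) + 1 = p + 2 + 2 * i"
    using p_eq by auto
  then have 2: "b * scaled_cbin (n + 1 + Suc i) = b' * scaled_cbin (n + 1 + i)"
    using scaled_cbin_Suc[of "n + 1 + i"] by (simp only: a_def a'_def b_def b'_def) simp
  have IH: "rat_cong p 1 (scaled_cbin (2 * n - i)) (s * scaled_cbin (n + 1 + i))"
    using Suc by (simp add: s_def)
  have "a * b * scaled_cbin (2 * n - Suc i) = a' * b * scaled_cbin (2 * n - i)"
    using 1 by (simp add: mult_ac)
  also have "rat_cong p 1 \<dots> (a' * b * (s * scaled_cbin (n + 1 + i)))"
    by (intro rat_cong_mult IH rat_cong_refl) (auto simp: a'_def b_def)
  also have "rat_cong p 1 \<dots> (a * b' * (s * scaled_cbin (n + 1 + i)))"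
  proof (intro rat_cong_mult[OF _ rat_cong_refl])
    show "p_integral p (s * scaled_cbin (n + 1 + i))"
      using IH by (rule rat_cong_imp_integral)
    define q where "q = 2 * int i + 2"
    have "a' * b = of_int ((2 * int p - q) * (int p + q + 1))"
      "a * b' = of_int ((2 * int p - q - 1) * (int p + q))"
      using Suc.prems p_eq by (simp_all add: a'_def b'_def a_def b_def q_def of_nat_diff)
    moreover have "(2 * int p - q) * (int p + q + 1) - (2 * int p - q - 1) * (int p + q) = int p * 3"
      by (simp add: algebra_simps)
    ultimately show "rat_cong p 1 (a' * b) (a * b')"
      by (metis cong_of_int dvd_triv_left)
  qed
  also have "a * b' * (s * scaled_cbin (n + 1 + i)) = a * b * (s * scaled_cbin (n + 1 + Suc i))"
    using 2 by (simp add: mult_ac)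
  finally have "rat_cong p 1 (a * b * scaled_cbin (2 * n - Suc i)) (a * b * (s * scaled_cbin (n + 1 + Suc i)))" .
  from rat_cong_mult_cancel[OF this] show ?case
    using inv nz by (auto simp: inverse_mult_distrib s_def)
qed

text \<open>Both terms carry \<open>p ^ 3\<close>, so the cofactors matter only modulo
  \<open>p\<close>. There \<open>4k + 1\<close> and \<open>4l + 1\<close> are opposite because they
  add up to \<open>6p\<close>, and the signs combine to make the remaining factors equal.\<close>

lemma cong_upper_terms:
  assumes "i < n"
  defines "t \<equiv> \<lambda>k. of_nat (4 * k + 1) * cbin k ^ 3 / (-64) ^ k"
  shows "rat_cong p 4 (t (n + 1 + i) + t (2 * n - i)) 0"
proof -
  define d k l where "d = scaled_cbin" and "k = n + 1 + i" and "l = 2 * n - i"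
  have t: "t j = of_nat p ^ 3 * (of_nat (4 * j + 1) * (- 1) ^ j * d j ^ 3)" for j
  proof -
    have "(4 ^ j) ^ 3 = (64 :: rat) ^ j" using power_mult[of "4 :: rat" j 3] power_mult[of "4 :: rat" 3 j] by (simp add: mult.commute)
    moreover have "(- 64) ^ j = (- 1) ^ j * (64 :: rat) ^ j" by (simp flip: power_mult_distrib)
    moreover have "x * C ^ 3 / ((- 1) ^ j * E) = P ^ 3 * (x * (- 1) ^ j * (C ^ 3 / E / P ^ 3))" if "P \<noteq> 0" for x C E P :: rat
      using that by (cases "even j") simp_all
    moreover have "of_nat p \<noteq> (0 :: rat)" using p_eq by simp
    ultimately show ?thesis unfolding t_def d_def scaled_cbin_def power_divide by (simp only: not_False_eq_True)
  qed
  have d: "rat_cong p 1 (d l) ((- 1) ^ (n + 1) * d k)"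
    unfolding d_def l_def k_def by (rule scaled_cbin_reflect[OF assms(1)])
  \<comment> \<open>Integrality of \<open>d k\<close> is read off from the reflection congruence,
    after removing the sign.\<close>
  have "d k = (- 1) ^ (n + 1) * ((- 1) ^ (n + 1) * d k)"
    by (simp flip: mult.assoc power_add)
  then have int: "p_integral p (d k)"
    using rat_cong_imp_integral(2)[OF d] by (metis p_integral_mult p_integral_power p_integral_minus p_integral_1)
  have kl: "k + l = 3 * n + 1" using assms(1) by (simp add: k_def l_def)
  then have "int (4 * l + 1) - - int (4 * k + 1) = int p * 6" by (simp add: p_eq)
  then have "rat_cong p 1 (of_nat (4 * l + 1)) (- of_nat (4 * k + 1))"
    using cong_of_int[of "int (4 * l + 1)" "- int (4 * k + 1)"] by simp
  then have "rat_cong p 1 (of_nat (4 * l + 1) * (- 1) ^ l * d l ^ 3)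
      (- of_nat (4 * k + 1) * (- 1) ^ l * ((- 1) ^ (n + 1) * d k) ^ 3)"
    by (intro rat_cong_mult rat_cong_power d rat_cong_refl p_integral_power p_integral_minus) auto
  also have "- of_nat (4 * k + 1) * (- 1) ^ l * ((- 1) ^ (n + 1) * d k) ^ 3
      = - of_nat (4 * k + 1) * ((- 1) ^ l * (- 1) ^ (3 * n + 3)) * d k ^ 3"
  proof -
    have "((- 1) ^ (n + 1) * d k) ^ 3 = (- 1) ^ (3 * n + 3) * d k ^ 3"
    proof -
      have "(n + 1) * 3 = 3 * n + 3" by simp
      then show ?thesis by (simp only: power_mult_distrib power_mult[symmetric])
    qed
    then show ?thesis by (simp only: mult.assoc)
  qed
  also have "(- 1 :: rat) ^ l * (- 1) ^ (3 * n + 3) = (- 1) ^ k"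
  proof -
    have "l + (3 * n + 3) = k + 2 * (l + 1)" using kl by simp
    then show ?thesis by (simp only: power_add[symmetric]) (simp add: power_add)
  qed
  finally have "rat_cong p 1 (of_nat (4 * k + 1) * (- 1) ^ k * d k ^ 3 + of_nat (4 * l + 1) * (- 1) ^ l * d l ^ 3)
      (of_nat (4 * k + 1) * (- 1) ^ k * d k ^ 3 + - of_nat (4 * k + 1) * (- 1) ^ k * d k ^ 3)"
    using int by (intro rat_cong_add rat_cong_refl p_integral_mult p_integral_power p_integral_minus) auto
  then have "rat_cong p 1 (of_nat (4 * k + 1) * (- 1) ^ k * d k ^ 3 + of_nat (4 * l + 1) * (- 1) ^ l * d l ^ 3) 0"
    by (simp only: mult_minus_left right_minus)
  from rat_cong_scale[OF this, of 3]
  have "rat_cong p 4 (of_nat p ^ 3 * (of_nat (4 * k + 1) * (- 1) ^ k * d k ^ 3)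
      + of_nat p ^ 3 * (of_nat (4 * l + 1) * (- 1) ^ l * d l ^ 3)) 0"
    unfolding distrib_left[symmetric] by simp
  then show ?thesis
    unfolding t k_def[symmetric] l_def[symmetric] .
qed

lemma cong_full_sum:
  defines "t \<equiv> \<lambda>k. of_nat (4 * k + 1) * cbin k ^ 3 / (-64) ^ k"
  shows "rat_cong p 4 (\<Sum>k=0..2 * n. t k) (\<Sum>k=0..n. t k)"
proof -
  define U where "U = (\<Sum>k=n + 1..2 * n. t k)"
  have U1: "U = (\<Sum>i<n. t (n + 1 + i))"
    unfolding U_def by (rule sum.reindex_bij_witness[where i = "\<lambda>i. n + 1 + i" and j = "\<lambda>k. k - (n + 1)"]) auto
  have U2: "U = (\<Sum>i<n. t (2 * n - i))"
    unfolding U_def by (rule sum.reindex_bij_witness[where i = "\<lambda>i. 2 * n - i" and j = "\<lambda>k. 2 * n - k"]) auto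
  \<comment> \<open>Summing over all \<open>i\<close> counts every term twice, so an index that is
    its own reflection needs no separate case; 2 is a unit.\<close>
  have "of_nat 2 * U = (\<Sum>i<n. t (n + 1 + i) + t (2 * n - i))"
    unfolding sum.distrib U1[symmetric] U2[symmetric] by simp
  also have "rat_cong p 4 \<dots> (\<Sum>i<n. 0)"
    using cong_upper_terms by (intro rat_cong_sum) (simp add: t_def)
  finally have "rat_cong p 4 (of_nat 2 * U) (of_nat 2 * 0)" by simp
  then have U: "rat_cong p 4 U 0"
    by (rule rat_cong_mult_cancel) (use unit_less[of 2] n_pos p_eq in auto)
  have "p_integral p (t k)" for k
  proof -
    have "p_integral p (inverse (- 64))" using p_integral_minus[OF unit_pow2[of 6]] by simp
    then have "p_integral p (inverse ((- 64) ^ k))"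
      using p_integral_power[of p "inverse (- 64)" k] by (simp only: power_inverse)
    then show ?thesis unfolding t_def by (intro p_integral_divide p_integral_mult p_integral_power) auto
  qed
  moreover have "(\<Sum>k=0..2 * n. t k) = (\<Sum>k=0..n. t k) + U"
    unfolding U_def using sum.ub_add_nat[of 0 n t n] by (simp add: mult_2)
  ultimately show ?thesis
    using rat_cong_add[OF rat_cong_refl U, of "\<Sum>k=0..n. t k"] by auto
qed

end

text \<open>The closed form is claimed only for \<open>p\<close> other than 3, in accordance with
  \<open>closed_form_fails_at_3\<close>; in the proof \<open>sum_inv_sq\<close> divides by
  3.\<close>

theorem theorem1p1:
  fixes p :: nat
  assumes "prime p" and "odd p"
  shows "rat_cong p 4
           (\<Sum>k = 0..p - 1. of_nat (4 * k + 1) * of_nat ((2 * k) choose k) ^ 3 / (- 64) ^ k)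
           (\<Sum>k = 0..(p - 1) div 2. of_nat (4 * k + 1) * of_nat ((2 * k) choose k) ^ 3 / (- 64) ^ k)
       \<and> (p \<noteq> 3 \<longrightarrow> rat_cong p 4
           (\<Sum>k = 0..(p - 1) div 2. of_nat (4 * k + 1) * of_nat ((2 * k) choose k) ^ 3 / (- 64) ^ k)
           (of_nat p * of_int (Legendre (- 1) (int p)) + of_nat p ^ 3 * of_int (euler_number (p - 3))))"
proof -
  obtain n where n: "p = 2 * n + 1" using assms(2) by (elim oddE)
  interpret odd_prime p n by unfold_locales (fact assms(1) n)+
  have "p - 1 = 2 * n" "(p - 1) div 2 = n" using n by simp_all
  then show ?thesis
    using cong_full_sum cong_truncated_sum by (simp only: cbin_def Legendre_minus_1) simp
qed

end
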